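(* Let $\omega:\mathbb{R}^d\to\mathbb{R}$ be continuously differentiable and $1$-strongly convex. Let $f,r:\mathbb{R}^d\to\mathbb{R}$ be proper and lower semicontinuous, $f$ being $\rho_f\omega$-relatively weakly convex and $r$ being $\rho_r\omega$-relatively weakly convex, with $\rho_f,\rho_r>0$. Put $F:=f+r$, $\rho_F:=\rho_f+\rho_r$, and assume $F^*:=\inf_{x\in\mathbb{R}^d}F(x)>-\infty$. Let $\{x^k\}_{k\ge 0}$ be generated by the Bregman proximal subgradient method: for each $k$, choose $g_k\in\partial f(x^k)$ and $$x^{k+1}\in\operatorname*{arg\,min}_{x\in\mathbb{R}^d}\Big\{\langle g_k,x-x^k\rangle+r(x)+\frac1{t_k}D_\omega(x,x^k)\Big\},$$ with step sizes $t_k>0$. Let $K$ be a positive integer. For a parameter $\lambda\in(0,1/\rho_F)$ write $\hat x^k:=\operatorname{prox}^\omega_{\lambda F}(x^k)$ (when $D^{\mathrm{sym}}_{\omega,1/(2\rho_F)}(\hat x^k,x^k)$ is written, $\hat x^k$ is taken with $\lambda=1/(2\rho_F)$). Then the following hold. (a) Suppose there is $L_F>0$ with $\|g\|\le L_F$ for all $x\in\mathbb{R}^d$ and all $g\in\partial F(x)$. For any $\lambda\in(0,1/\rho_F)$ and any $\{t_k\}_{k\ge0}\subset(0,\lambda]$, $$\min_{0\le k\le K-1}D^{\mathrm{sym}}_{\omega,\lambda}(\hat x^k,x^k)\le\frac{F^\omega_\lambda(x^0)-F^*+\frac{L_F^2}{2\lambda(1-\lambda\rho_r)^2}\sum_{k=0}^{K-1}t_k^2}{(1-\lambda\rho_F)\sum_{k=0}^{K-1}t_k}.$$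 In particular, with constant step size $t_k=\min\Big\{\frac1{2\rho_F},\ \frac{1-\rho_r/(2\rho_F)}{L_F}\sqrt{\frac{\delta}{\rho_FK}}\Big\}$ for some $\delta>0$ with $\delta\ge F^\omega_{1/(2\rho_F)}(x^0)-F^*$, $$\min_{0\le k\le K-1}D^{\mathrm{sym}}_{\omega,1/(2\rho_F)}(\hat x^k,x^k)\le 8\max\Big\{\frac{\rho_F\delta}{K},\ L_F\sqrt{\frac{\rho_F\delta}{K}}\Big\}.$$ (b) Suppose that for any given $\lambda$ there are $\alpha_1,\beta_1>0$ (which may depend on $\lambda$) such that $\|g\|\le\sqrt{\alpha_1[F^\omega_\lambda(x)-F^*]+\beta_1}$ for all $x\in\mathbb{R}^d$ and all $g\in\partial F(x)$. For any $\lambda\in(0,1/\rho_F)$ (with $\alpha_1,\beta_1$ the corresponding constants) and any $\{t_k\}_{k\ge0}\subset(0,\lambda]$ with $\sum_{k=0}^{K-1}t_k^2\le C$ for some $C>0$, $$\min_{0\le k\le K-1}D^{\mathrm{sym}}_{\omega,\lambda}(\hat x^k,x^k)\le\frac{F^\omega_\lambda(x^0)-F^*+\frac{\alpha_1C_F+\beta_1}{2\lambda(1-\lambda\rho_r)^2}\sum_{k=0}^{K-1}t_k^2}{(1-\lambda\rho_F)\sum_{k=0}^{K-1}t_k},$$ where $C_F=\Big(F^\omega_\lambda(x^0)-F^*+\frac{C\beta_1}{2(1-\lambda\rho_r)^2\lambda}\Big)\exp\Big(\frac{C\alpha_1}{2(1-\lambda\rho_r)^2\lambda}\Big)$. In particular,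 let $\bar C>0$ be fixed, let $\alpha_1,\beta_1$ be the constants for $\lambda=1/(2\rho_F)$, and let $\delta>0$ with $\delta\ge F^\omega_{1/(2\rho_F)}(x^0)-F^*$ and $\bar C_F:=(\delta+4\bar C\beta_1\rho_F)e^{4\bar C\alpha_1\rho_F}$. With constant step size $t_k=\min\Big\{\frac1{2\rho_F},\ \sqrt{\frac{(1-\frac{\rho_r}{2\rho_F})^2\delta}{\rho_F(\alpha_1\bar C_F+\beta_1)K}},\ \sqrt{\frac{\bar C}{K}}\Big\}$, $$\min_{0\le k\le K-1}D^{\mathrm{sym}}_{\omega,1/(2\rho_F)}(\hat x^k,x^k)\le 8\max\Big\{\frac{\rho_F\delta}{K},\ \sqrt{\frac{(\alpha_1\bar C_F+\beta_1)\rho_F\delta}{K}},\ \frac{\delta}{2\sqrt{\bar CK}}\Big\}.$$ (c) Suppose there is $L_f>0$ with $\|g\|\le L_f$ for all $x\in\mathbb{R}^d$ and all $g\in\partial f(x)$, and that $x^0\in\operatorname{dom}r$. For any $\lambda\in(0,1/\rho_F)$ and any nonincreasing step size sequence $\{t_k\}_{k\ge0}$ with $1-t_k\rho_r>0$, $$\min_{0\le k\le K-1}D^{\mathrm{sym}}_{\omega,\lambda}(\hat x^k,x^k)\le\frac{F^\omega_\lambda(x^0)-F^*+\frac{t_0}{\lambda(1-t_0\rho_r)}(F(x^0)-F^* )+\frac{2L_f^2}{\lambda}\sum_{k=0}^{K-1}\frac{t_k^2}{1-t_k\rho_r}}{(1-\lambda\rho_F)\sum_{k=0}^{K-1}\frac{t_k}{1-t_k\rho_r}}.$$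 In particular, with $\lambda=\frac1{2\rho_F}$ and constant step size $t_k=\min\Big\{\frac1{2\rho_F},\ \frac1{2L_f}\sqrt{\frac{\delta}{\rho_FK}}\Big\}$ for some $\delta>0$ with $\delta\ge\max\{F^\omega_{1/(2\rho_F)}(x^0)-F^*,\ F(x^0)-F^*\}$, $$\min_{0\le k\le K-1}D^{\mathrm{sym}}_{\omega,1/(2\rho_F)}(\hat x^k,x^k)\le 8\max\Big\{\frac{3\rho_F\delta}{K},\ 4L_f\sqrt{\frac{\rho_F\delta}{K}}\Big\}.$$
   Context: $\|\cdot\|$ and $\langle\cdot,\cdot\rangle$ are the Euclidean norm and inner product on $\mathbb{R}^d$; $\omega$ is $1$-strongly convex if $\omega-\frac12\|\cdot\|^2$ is convex. The Bregman distance is $D_\omega(y,x):=\omega(y)-\omega(x)-\langle\nabla\omega(x),y-x\rangle$. A proper lower semicontinuous function $\varphi$ is $\rho\omega$-relatively weakly convex if $\varphi+\rho\omega$ is convex; its subdifferential is then $\partial\varphi(x)=\partial(\varphi+\rho\omega)(x)-\rho\nabla\omega(x)$, where the right-hand $\partial$ is the convex subdifferential (so $\varphi(x)\ge\varphi(z)+\langle g,x-z\rangle-\rho D_\omega(x,z)$ for $g\in\partial\varphi(z)$). Under the hypotheses $F$ is $\rho_F\omega$-relatively weakly convex. Bregman Moreau envelope and proximal map: $F^\omega_\lambda(x):=\min_y\{F(y)+\frac1\lambda D_\omega(y,x)\}$ and $\operatorname{prox}^\omega_{\lambda F}(x):=\operatorname*{arg\,min}_y\{F(y)+\frac1\lambda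 D_\omega(y,x)\}$ (single-valued for $\lambda\in(0,1/\rho_F)$). Bregman stationarity measure: $D^{\mathrm{sym}}_{\omega,\lambda}(u,x):=\frac1{\lambda^2}\big(D_\omega(u,x)+D_\omega(x,u)\big)$, used with $u=\operatorname{prox}^\omega_{\lambda F}(x)$. $\operatorname{dom}r:=\{x: r(x)<\infty\}$. *)

theory Defs
  imports "HOL-Analysis.Analysis"
begin

section \<open>Extended-real-valued functions\<close>

definition proper_fun :: "('a \<Rightarrow> ereal) \<Rightarrow> bool" where
  "proper_fun \<phi> \<longleftrightarrow> (\<forall>x. \<phi> x \<noteq> -\<infinity>) \<and> (\<exists>x. \<phi> x < \<infinity>)"

definition effective_dom :: "('a \<Rightarrow> ereal) \<Rightarrow> 'a set" where
  "effective_dom \<phi> = {x. \<phi> x < \<infinity>}"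

definition lower_semicont :: "('a::topological_space \<Rightarrow> ereal) \<Rightarrow> bool" where
  "lower_semicont \<phi> \<longleftrightarrow> (\<forall>x. \<phi> x \<le> Liminf (at x) \<phi>)"

text \<open>The convention \<open>0 * \<infinity> = 0\<close> of \<^typ>\<open>ereal\<close> makes the cases \<open>u = 0\<close> and \<open>v = 0\<close> harmless.
  The definition is meant for functions that do not take the value \<open>-\<infinity>\<close>.\<close>

definition ereal_convex :: "('a::real_vector \<Rightarrow> ereal) \<Rightarrow> bool" where
  "ereal_convex \<phi> \<longleftrightarrow>
     (\<forall>x y. \<forall>u\<ge>0. \<forall>v\<ge>0. u + v = 1 \<longrightarrow>
        \<phi> (u *\<^sub>R x + v *\<^sub>R y) \<le> ereal u * \<phi> x + ereal v * \<phi> y)"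

definition convex_subdiff :: "('a::real_inner \<Rightarrow> ereal) \<Rightarrow> 'a \<Rightarrow> 'a set" where
  "convex_subdiff \<phi> x =
     {g. \<bar>\<phi> x\<bar> \<noteq> \<infinity> \<and> (\<forall>y. \<phi> y \<ge> \<phi> x + ereal (g \<bullet> (y - x)))}"


section \<open>The kernel and its Bregman distance\<close>

definition continuously_differentiable :: "('a::real_inner \<Rightarrow> real) \<Rightarrow> bool" where
  "continuously_differentiable \<omega> \<longleftrightarrow>
     (\<exists>G. (\<forall>x. GDERIV \<omega> x :> G x) \<and> continuous_on UNIV G)"

definition strongly_convex_1 :: "('a::real_inner \<Rightarrow> real) \<Rightarrow> bool" where
  "strongly_convex_1 \<omega> \<longleftrightarrow> convex_on UNIV (\<lambda>x. \<omega> x - 1 / 2 * (norm x)\<^sup>2)"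

definition nabla :: "('a::real_inner \<Rightarrow> real) \<Rightarrow> 'a \<Rightarrow> 'a" where
  "nabla \<omega> x = (THE D. GDERIV \<omega> x :> D)"

definition bregman :: "('a::real_inner \<Rightarrow> real) \<Rightarrow> 'a \<Rightarrow> 'a \<Rightarrow> real" where
  "bregman \<omega> y x = \<omega> y - \<omega> x - nabla \<omega> x \<bullet> (y - x)"


section \<open>Relative weak convexity\<close>

definition rel_weakly_convex :: "real \<Rightarrow> ('a::real_vector \<Rightarrow> real) \<Rightarrow> ('a \<Rightarrow> ereal) \<Rightarrow> bool" where
  "rel_weakly_convex \<rho> \<omega> \<phi> \<longleftrightarrow> ereal_convex (\<lambda>x. \<phi> x + ereal (\<rho> * \<omega> x))"

definition rel_subdiff :: "real \<Rightarrow> ('a::real_inner \<Rightarrow> real) \<Rightarrow> ('a \<Rightarrow> ereal) \<Rightarrow> 'a \<Rightarrow> 'a set" where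
  "rel_subdiff \<rho> \<omega> \<phi> x =
     {h - \<rho> *\<^sub>R nabla \<omega> x |h. h \<in> convex_subdiff (\<lambda>y. \<phi> y + ereal (\<rho> * \<omega> y)) x}"


section \<open>Bregman Moreau envelope, proximal map and stationarity measure\<close>

text \<open>The minimum defining the envelope is written as an infimum in the complete lattice
  \<^typ>\<open>ereal\<close>; the two agree whenever the minimum is attained.  The proximal map picks a
  minimiser by \<^const>\<open>arg_min\<close>; it is meant for parameters for which the minimiser exists
  and is unique.\<close>

definition bregman_envelope ::
    "('a::real_inner \<Rightarrow> real) \<Rightarrow> real \<Rightarrow> ('a \<Rightarrow> ereal) \<Rightarrow> 'a \<Rightarrow> ereal" where
  "bregman_envelope \<omega> lam F x = (INF y. F y + ereal (1 / lam * bregman \<omega> y x))"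

definition bregman_prox ::
    "('a::real_inner \<Rightarrow> real) \<Rightarrow> real \<Rightarrow> ('a \<Rightarrow> ereal) \<Rightarrow> 'a \<Rightarrow> 'a" where
  "bregman_prox \<omega> lam F x = arg_min (\<lambda>y. F y + ereal (1 / lam * bregman \<omega> y x)) (\<lambda>_. True)"

definition D_sym :: "('a::real_inner \<Rightarrow> real) \<Rightarrow> real \<Rightarrow> 'a \<Rightarrow> 'a \<Rightarrow> real" where
  "D_sym \<omega> lam u x = 1 / lam\<^sup>2 * (bregman \<omega> u x + bregman \<omega> x u)"


section \<open>The Bregman proximal subgradient method\<close>

definition bregman_prox_subgradient ::
    "('a::real_inner \<Rightarrow> real) \<Rightarrow> real \<Rightarrow> ('a \<Rightarrow> ereal) \<Rightarrow> ('a \<Rightarrow> ereal) \<Rightarrow>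
     (nat \<Rightarrow> real) \<Rightarrow> (nat \<Rightarrow> 'a) \<Rightarrow> (nat \<Rightarrow> 'a) \<Rightarrow> bool" where
  "bregman_prox_subgradient \<omega> \<rho>f f r t g x \<longleftrightarrow>
     (\<forall>k. t k > 0 \<and> g k \<in> rel_subdiff \<rho>f \<omega> f (x k) \<and>
        is_arg_min
          (\<lambda>z. ereal (g k \<bullet> (z - x k)) + r z + ereal (1 / t k * bregman \<omega> z (x k)))
          (\<lambda>_. True) (x (Suc k)))"

end

theory Submission
  imports Defs
begin

text \<open>
  The objective gap of the Bregman Moreau envelope, \<open>F\<^sup>\<omega>\<^sub>\<lambda>(x\<^sup>k) - F\<^sup>*\<close>, is a Lyapunov function.
  Testing the optimality condition of the subproblem with \<open>h = prox(x\<^sup>k)\<close> and using the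
  subgradient inequality of \<open>F\<close> at \<open>h\<close> shows that one step decreases the gap by a multiple of
  \<open>t\<^sub>k\<close> times the stationarity measure, up to the error
  \<open>t\<^sub>k (r(x\<^sup>k) - r(x\<^sup>k\<^sup>+\<^sup>1) + \<langle>g\<^sub>k, x\<^sup>k - x\<^sup>k\<^sup>+\<^sup>1\<rangle>) - D(x\<^sup>k\<^sup>+\<^sup>1, x\<^sup>k)\<close>.
  A locally bounded subdifferential forces the function to be finite everywhere, with a
  difference quotient controlled by the subgradient bound; this turns the error into
  \<open>O(t\<^sub>k\<^sup>2)\<close>, plus a telescoping difference of objective values in the Lipschitz case.
  Part (b) needs in addition a discrete Gronwall inequality, part (c) an Abel summation.
\<close>

section \<open>Lower semicontinuity, relative weak convexity and subgradients\<close>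

text \<open>The bounds in (a) and (b) concern subgradients of \<open>F\<close>, while the method
  treats \<open>f\<close> and \<open>r\<close> separately and provides a subgradient of
  \<open>f\<close> alone at \<open>x k\<close>. The increment of \<open>r\<close>, corrected by
  \<open>g k\<close>, therefore has to be controlled through \<open>F\<close>; the route goes
  through finite increments, so no sum rule for subdifferentials enters. In (b) the bound moreover
  varies with the point through the envelope, which is why the increment estimates allow a
  continuous function \<open>m\<close> in place of a constant. The error constants come from Young's
  inequality. In (a) and (b) the term \<open>t * \<rho>r * D x' x\<close>, caused by the weak
  convexity of \<open>r\<close>, is absorbed first, so the quadratic left over has coefficient
  \<open>1 - t * \<rho>r\<close>. A second such factor stems from the left side of the descent
  inequality, hence the square, which \<open>t \<le> lam\<close> then freezes at \<open>lam\<close>.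
  In (c) all of \<open>D x' x\<close> is available to Young's inequality, so the factor occurs once
  and the step sizes are not tied to \<open>lam\<close>.\<close>

lemma lower_semicont_iff:
  fixes \<phi> :: "'a::t1_space \<Rightarrow> ereal"
  shows "lower_semicont \<phi> \<longleftrightarrow> (\<forall>z. \<forall>c<\<phi> z. \<forall>\<^sub>F y in nhds z. c < \<phi> y)"
  unfolding lower_semicont_def le_Liminf_iff
  \<comment> \<open>The liminf ignores the point itself, but \<open>c < \<phi> z\<close> covers it.
    The full filter \<open>nhds z\<close> is the one that composes with convergent
    sequences.\<close>
  by (auto simp: eventually_nhds_conv_at)

lemma lower_semicont_add:
  fixes \<phi> \<psi> :: "'a::t1_space \<Rightarrow> ereal"
  assumes "lower_semicont \<phi>" "lower_semicont \<psi>"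
    and "\<And>y. \<phi> y \<noteq> -\<infinity>" "\<And>y. \<psi> y \<noteq> -\<infinity>"
  shows "lower_semicont (\<lambda>y. \<phi> y + \<psi> y)"
  unfolding lower_semicont_iff
proof (intro allI impI)
  fix z c assume c: "c < \<phi> z + \<psi> z"
  obtain u v where uv: "u < \<phi> z" "v < \<psi> z" "c \<le> u + v"
  proof (cases "c = -\<infinity>")
    case True
    then show ?thesis using that[of "-\<infinity>" "-\<infinity>"] assms(3)[of z] assms(4)[of z] by auto
  next
    case False
    then obtain c' where c': "c = ereal c'" using c by (cases c) auto
    obtain a where a: "c' - a < \<psi> z" "ereal a < \<phi> z"
    proof -
      show ?thesis
      proof (cases "\<phi> z")
        case (real p)
        show ?thesis
        proof (cases "\<psi> z")
          case (real q)
          with \<open>\<phi> z = ereal p\<close> c c' have "c' < p + q" by simp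
          then show ?thesis
            \<comment> \<open>Each summand receives half of the slack
              \<open>p + q - c'\<close>.\<close>
            using that[of "p - (p + q - c') / 2"] real \<open>\<phi> z = ereal p\<close> by (auto simp: field_simps)
        qed (use that[of "p - 1"] real assms(4)[of z] in auto)
      next
        case PInf
        show ?thesis
        proof (cases "\<psi> z")
          case (real q)
          then show ?thesis using that[of "c' - q + 1"] PInf by auto
        qed (use that[of 0] PInf assms(4)[of z] in auto)
      qed (use assms(3)[of z] in auto)
    qed
    then show ?thesis using that[of "ereal a" "ereal (c' - a)"] c' by auto
  qed
  have "\<forall>\<^sub>F y in nhds z. u < \<phi> y" "\<forall>\<^sub>F y in nhds z. v < \<psi> y"
    using assms(1,2) uv unfolding lower_semicont_iff by blast+
  then show "\<forall>\<^sub>F y in nhds z. c < \<phi> y + \<psi> y"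
  proof eventually_elim
    case (elim y)
    have "u + v < \<phi> y + \<psi> y"
      using elim assms(3)[of y] assms(4)[of y]
      by (cases "\<phi> y"; cases "\<psi> y"; cases u; cases v) auto
    then show ?case using uv by simp
  qed
qed

lemma lower_semicont_continuous:
  fixes \<psi> :: "'a::t1_space \<Rightarrow> real"
  assumes "continuous_on UNIV \<psi>"
  shows "lower_semicont (\<lambda>y. ereal (\<psi> y))"
  unfolding lower_semicont_iff
proof (intro allI impI)
  fix z c assume c: "c < ereal (\<psi> z)"
  have "((\<lambda>y. ereal (\<psi> y)) \<longlongrightarrow> ereal (\<psi> z)) (nhds z)"
    using assms by (simp add: continuous_on_def flip: tendsto_at_iff_tendsto_nhds)
  then show "\<forall>\<^sub>F y in nhds z. c < ereal (\<psi> y)"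
    using c by (rule order_tendstoD)
qed

text \<open>A minimising sequence has a subsequence converging to some \<open>p\<close> in
  \<open>S\<close>. A value \<open>c\<close> strictly between the infimum and
  \<open>\<phi> p\<close> would be exceeded along it by semicontinuity and undercut by convergence
  of the values. The argument stays in \<open>ereal\<close>, so infinite infima are
  included.\<close>

lemma lower_semicont_attains_min:
  fixes \<phi> :: "'a::metric_space \<Rightarrow> ereal"
  assumes lsc: "lower_semicont \<phi>" and S: "compact S" "S \<noteq> {}"
  obtains p where "p \<in> S" "\<And>y. y \<in> S \<Longrightarrow> \<phi> p \<le> \<phi> y"
proof -
  define i where "i = (INF y\<in>S. \<phi> y)"
  obtain w where w: "\<And>n::nat. w n \<in> \<phi> ` S" "w \<longlonglongrightarrow> i"
    using Inf_as_limit[of "\<phi> ` S"] S unfolding i_def by auto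
  then have "\<forall>n. \<exists>u\<in>S. w n = \<phi> u" by auto
  then obtain u where u: "\<And>n. u n \<in> S" "\<And>n. w n = \<phi> (u n)" by metis
  obtain p \<sigma> where p: "p \<in> S" "strict_mono (\<sigma> :: nat \<Rightarrow> nat)" "(u \<circ> \<sigma>) \<longlonglongrightarrow> p"
    using S(1) u(1) unfolding compact_def by metis
  have "\<phi> p \<le> i"
  proof (rule ccontr)
    assume "\<not> \<phi> p \<le> i"
    then obtain c where c: "i < c" "c < \<phi> p" by (meson dense not_le)
    have "\<forall>\<^sub>F n in sequentially. c < \<phi> ((u \<circ> \<sigma>) n)"
      by (rule eventually_compose_filterlim[OF lsc[unfolded lower_semicont_iff, rule_format, OF c(2)] p(3)])
    moreover have "\<forall>\<^sub>F n in sequentially. w (\<sigma> n) < c"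
      using order_tendstoD(2)[OF LIMSEQ_subseq_LIMSEQ[OF w(2) p(2)] c(1)] by simp
    ultimately have "\<forall>\<^sub>F n in sequentially. False"
      by eventually_elim (simp add: u(2) less_asym)
    then show False by simp
  qed
  then have "\<phi> p \<le> \<phi> y" if "y \<in> S" for y
    using INF_lower[OF that, of \<phi>] unfolding i_def by (rule order_trans)
  with p(1) show ?thesis by (rule that)
qed

section \<open>Calculus of relatively weakly convex functions and their subgradients\<close>

lemma rel_weakly_convexD:
  assumes "rel_weakly_convex \<rho> \<omega> \<phi>" "\<phi> x = ereal a" "\<phi> y = ereal b" "0 \<le> u" "0 \<le> v" "u + v = 1"
  shows "\<phi> (u *\<^sub>R x + v *\<^sub>R y) \<le>
    ereal (u * a + v * b + \<rho> * (u * \<omega> x + v * \<omega> y - \<omega> (u *\<^sub>R x + v *\<^sub>R y)))"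
proof -
  have "\<phi> (u *\<^sub>R x + v *\<^sub>R y) + ereal (\<rho> * \<omega> (u *\<^sub>R x + v *\<^sub>R y))
      \<le> ereal u * (\<phi> x + ereal (\<rho> * \<omega> x)) + ereal v * (\<phi> y + ereal (\<rho> * \<omega> y))"
    using assms(1,4-6) unfolding rel_weakly_convex_def ereal_convex_def by blast
  then show ?thesis
    using assms(2,3) by (cases "\<phi> (u *\<^sub>R x + v *\<^sub>R y)") (auto simp: algebra_simps)
qed

text \<open>Finite values suffice: with two positive weights an infinite value makes the right-hand
  side infinite, and a zero weight is harmless by \<open>0 * \<infinity> = 0\<close>.\<close>

lemma rel_weakly_convexI:
  assumes "\<And>y. \<phi> y \<noteq> -\<infinity>"
    and "\<And>x y a b u v. \<phi> x = ereal a \<Longrightarrow> \<phi> y = ereal b \<Longrightarrow> 0 \<le> u \<Longrightarrow> 0 \<le> v \<Longrightarrow> u + v = 1 \<Longrightarrow>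
      \<phi> (u *\<^sub>R x + v *\<^sub>R y) \<le>
      ereal (u * a + v * b + \<rho> * (u * \<omega> x + v * \<omega> y - \<omega> (u *\<^sub>R x + v *\<^sub>R y)))"
  shows "rel_weakly_convex \<rho> \<omega> \<phi>"
  unfolding rel_weakly_convex_def ereal_convex_def
proof (intro allI impI)
  fix x y and u v :: real assume uv: "0 \<le> u" "0 \<le> v" "u + v = 1"
  consider "u = 0" | "v = 0" | "u > 0" "v > 0" using uv by fastforce
  then show "\<phi> (u *\<^sub>R x + v *\<^sub>R y) + ereal (\<rho> * \<omega> (u *\<^sub>R x + v *\<^sub>R y))
      \<le> ereal u * (\<phi> x + ereal (\<rho> * \<omega> x)) + ereal v * (\<phi> y + ereal (\<rho> * \<omega> y))"
  proof cases
    case 3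
    show ?thesis
    proof (cases "\<phi> x = \<infinity> \<or> \<phi> y = \<infinity>")
      case True
      then show ?thesis using 3 assms(1)[of x] assms(1)[of y] by (cases "\<phi> x"; cases "\<phi> y") auto
    next
      case False
      then obtain a b where "\<phi> x = ereal a" "\<phi> y = ereal b"
        using assms(1)[of x] assms(1)[of y] by (cases "\<phi> x"; cases "\<phi> y") auto
      with assms(2)[OF this uv] show ?thesis
        by (cases "\<phi> (u *\<^sub>R x + v *\<^sub>R y)") (auto simp: algebra_simps)
    qed
  qed (use uv in \<open>auto simp: zero_ereal_def[symmetric] one_ereal_def[symmetric]\<close>)
qed

text \<open>Once the convexity gap of \<open>\<omega>\<close> stands on the right, as in
  \<open>rel_weakly_convexD\<close>, the two inequalities add and so do the moduli.\<close>

lemma rel_weakly_convex_add: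
  assumes "rel_weakly_convex \<rho> \<omega> f" "rel_weakly_convex \<rho>' \<omega> r"
    and "\<And>y. f y \<noteq> -\<infinity>" "\<And>y. r y \<noteq> -\<infinity>"
  shows "rel_weakly_convex (\<rho> + \<rho>') \<omega> (\<lambda>y. f y + r y)"
proof (rule rel_weakly_convexI)
  fix y show "f y + r y \<noteq> -\<infinity>" using assms(3,4)[of y] by auto
next
  fix x y a b and u v :: real
  assume *: "f x + r x = ereal a" "f y + r y = ereal b" and uv: "0 \<le> u" "0 \<le> v" "u + v = 1"
  obtain fx rx fy ry where v: "f x = ereal fx" "r x = ereal rx" "f y = ereal fy" "r y = ereal ry"
    using * assms(3,4)[of x] assms(3,4)[of y]
    by (cases "f x"; cases "r x"; cases "f y"; cases "r y") auto
  show "f (u *\<^sub>R x + v *\<^sub>R y) + r (u *\<^sub>R x + v *\<^sub>R y) \<le>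
    ereal (u * a + v * b + (\<rho> + \<rho>') * (u * \<omega> x + v * \<omega> y - \<omega> (u *\<^sub>R x + v *\<^sub>R y)))"
  proof -
    have ab: "a = fx + rx" "b = fy + ry" using * v by simp_all
    show ?thesis
      using add_mono[OF rel_weakly_convexD[OF assms(1) v(1,3) uv] rel_weakly_convexD[OF assms(2) v(2,4) uv]]
      unfolding ab by (simp add: algebra_simps)
  qed
qed

text \<open>The kernel values and the shift by \<open>\<rho> *\<^sub>R nabla \<omega> x\<close>
  collect into \<open>\<rho> * bregman \<omega> y x\<close>. This is pure algebra with
  \<open>nabla \<omega> x\<close> as a fixed vector, so it holds for every
  \<open>\<omega>\<close>.\<close>

lemma rel_subdiff_iff:
  "g \<in> rel_subdiff \<rho> \<omega> \<phi> x \<longleftrightarrow>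
    \<bar>\<phi> x\<bar> \<noteq> \<infinity> \<and> (\<forall>y. \<phi> x + ereal (g \<bullet> (y - x) - \<rho> * bregman \<omega> y x) \<le> \<phi> y)"
proof -
  have "g \<in> rel_subdiff \<rho> \<omega> \<phi> x \<longleftrightarrow>
      g + \<rho> *\<^sub>R nabla \<omega> x \<in> convex_subdiff (\<lambda>y. \<phi> y + ereal (\<rho> * \<omega> y)) x"
    unfolding rel_subdiff_def by (auto intro!: exI[of _ "g + \<rho> *\<^sub>R nabla \<omega> x"])
  also have "\<dots> \<longleftrightarrow> \<bar>\<phi> x\<bar> \<noteq> \<infinity> \<and>
      (\<forall>y. \<phi> x + ereal (g \<bullet> (y - x) - \<rho> * bregman \<omega> y x) \<le> \<phi> y)"
  proof -
    have "(\<phi> x + ereal (\<rho> * \<omega> x) + ereal ((g + \<rho> *\<^sub>R nabla \<omega> x) \<bullet> (y - x))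
        \<le> \<phi> y + ereal (\<rho> * \<omega> y)) =
      (\<phi> x + ereal (g \<bullet> (y - x) - \<rho> * bregman \<omega> y x) \<le> \<phi> y)" if "\<bar>\<phi> x\<bar> \<noteq> \<infinity>" for y
      using that by (cases "\<phi> x"; cases "\<phi> y") (auto simp: bregman_def algebra_simps)
    then show ?thesis unfolding convex_subdiff_def by (cases "\<phi> x") auto
  qed
  finally show ?thesis .
qed

lemma GDERIV_directional:
  assumes "GDERIV \<psi> p :> D"
  shows "((\<lambda>s. (\<psi> (p + s *\<^sub>R d) - \<psi> p) / s) \<longlongrightarrow> D \<bullet> d) (at_right 0)"
proof -
  have "(\<psi> has_derivative (\<lambda>h. h \<bullet> D)) (at (p + 0 *\<^sub>R d))"
    using assms by (simp add: gderiv_def)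
  moreover have "((\<lambda>s::real. p + s *\<^sub>R d) has_derivative (\<lambda>s. s *\<^sub>R d)) (at 0)"
    by (auto intro!: derivative_eq_intros)
  ultimately have "((\<lambda>s. \<psi> (p + s *\<^sub>R d)) has_derivative (\<lambda>s. (s *\<^sub>R d) \<bullet> D)) (at 0)"
    using has_derivative_compose by fastforce
  then have "((\<lambda>s. \<psi> (p + s *\<^sub>R d)) has_real_derivative (D \<bullet> d)) (at 0)"
    by (rule has_derivative_imp_has_field_derivative) (simp add: inner_commute)
  then have "((\<lambda>s. (\<psi> (p + s *\<^sub>R d) - \<psi> p) / s) \<longlongrightarrow> D \<bullet> d) (at 0)"
    by (simp add: DERIV_def)
  then show ?thesis by (rule filterlim_mono[OF _ order_refl at_le]) simp
qed

lemma GDERIV_unique: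
  fixes \<psi> :: "'a::real_inner \<Rightarrow> real"
  assumes "GDERIV \<psi> x :> u" "GDERIV \<psi> x :> v"
  shows "u = v"
proof -
  have "(\<lambda>h. h \<bullet> u) = (\<lambda>h. h \<bullet> v)"
    using assms has_derivative_unique unfolding gderiv_def by blast
  then have "(u - v) \<bullet> u = (u - v) \<bullet> v" by metis
  then have "(u - v) \<bullet> (u - v) = 0" by (simp add: inner_diff_right)
  then show ?thesis by simp
qed

section \<open>Sequences of real numbers and step sizes\<close>

text \<open>Each \<open>S k\<close> is replaced by the minimum before telescoping; positive weights
  make this legitimate whatever the sign of \<open>S k\<close>. The minimum over all
  \<open>K\<close> indices is fixed before the induction on \<open>n \<le> K\<close>.\<close>

lemma Min_le_of_decrease:
  fixes E w S e :: "nat \<Rightarrow> real"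
  assumes K: "0 < K" and c: "0 < c" and w: "\<And>k. k < K \<Longrightarrow> 0 < w k"
    and E: "0 \<le> E K"
    and step: "\<And>k. k < K \<Longrightarrow> E (Suc k) \<le> E k - c * w k * S k + e k"
  shows "(MIN k\<in>{0..K-1}. S k) \<le> (E 0 + (\<Sum>k=0..K-1. e k)) / (c * (\<Sum>k=0..K-1. w k))"
proof -
  have set_eq: "{0..K-1} = {..<K}" using K by auto
  define M where "M = (MIN k\<in>{..<K}. S k)"
  have M: "M \<le> S k" if "k < K" for k unfolding M_def using that by (intro Min_le) auto
  have "E K \<le> E 0 - c * M * (\<Sum>k<K. w k) + (\<Sum>k<K. e k)"
  proof -
    have "E n \<le> E 0 - c * M * (\<Sum>k<n. w k) + (\<Sum>k<n. e k)" if "n \<le> K" for n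
      using that
    proof (induction n)
      case (Suc n)
      then have "c * w n * M \<le> c * w n * S n"
        using c w[of n] M[of n] by (intro mult_left_mono) simp_all
      then show ?case using Suc step[of n] by (simp add: algebra_simps)
    qed simp
    then show ?thesis by simp
  qed
  then have "M * (c * (\<Sum>k<K. w k)) \<le> E 0 + (\<Sum>k<K. e k)" using E by (simp add: mult_ac)
  moreover have "0 < c * (\<Sum>k<K. w k)"
    using K c w by (intro mult_pos_pos sum_pos) auto
  ultimately show ?thesis unfolding set_eq M_def[symmetric] by (simp add: pos_le_divide_eq)
qed

text \<open>Induction with \<open>1 + \<alpha> * q n \<le> exp (\<alpha> * q n)\<close>; the partial
  sums of \<open>q\<close> accumulate in the exponent.\<close>

lemma discrete_Gronwall:
  fixes E q :: "nat \<Rightarrow> real"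
  assumes step: "\<And>k. k < n \<Longrightarrow> E (Suc k) \<le> E k + (\<alpha> * E k + \<beta>) * q k"
    and q: "\<And>k. k < n \<Longrightarrow> 0 \<le> q k" and nonneg: "0 \<le> \<alpha>" "0 \<le> \<beta>" "0 \<le> E 0"
  shows "E n \<le> (E 0 + \<beta> * (\<Sum>k<n. q k)) * exp (\<alpha> * (\<Sum>k<n. q k))"
  using step q
proof (induction n)
  case (Suc n)
  define Q where "Q = (\<Sum>k<n. q k)"
  have Q: "0 \<le> Q" unfolding Q_def using Suc.prems(2) by (intro sum_nonneg) simp
  have qn: "0 \<le> q n" using Suc.prems(2) by simp
  have "E (Suc n) \<le> (1 + \<alpha> * q n) * E n + \<beta> * q n"
    using Suc.prems(1)[of n] by (simp add: algebra_simps)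
  \<comment> \<open>The additive term is inflated by an exponential that is at least 1, so that both
    terms share the factor needed for the closed form at \<open>Suc n\<close>.\<close>
  also have "\<dots> \<le> exp (\<alpha> * q n) * ((E 0 + \<beta> * Q) * exp (\<alpha> * Q)) + \<beta> * q n * exp (\<alpha> * (Q + q n))"
  proof (rule add_mono)
    have IH: "E n \<le> (E 0 + \<beta> * Q) * exp (\<alpha> * Q)" unfolding Q_def using Suc by simp
    have "(1 + \<alpha> * q n) * E n \<le> (1 + \<alpha> * q n) * ((E 0 + \<beta> * Q) * exp (\<alpha> * Q))"
      using IH nonneg qn by (intro mult_left_mono) simp_all
    also have "\<dots> \<le> exp (\<alpha> * q n) * ((E 0 + \<beta> * Q) * exp (\<alpha> * Q))"
      using nonneg Q by (intro mult_right_mono exp_ge_add_one_self) simp_all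
    finally show "(1 + \<alpha> * q n) * E n \<le> exp (\<alpha> * q n) * ((E 0 + \<beta> * Q) * exp (\<alpha> * Q))" .
    have "\<beta> * q n * 1 \<le> \<beta> * q n * exp (\<alpha> * (Q + q n))"
      using nonneg Q qn by (intro mult_left_mono) simp_all
    then show "\<beta> * q n \<le> \<beta> * q n * exp (\<alpha> * (Q + q n))" by simp
  qed
  also have "\<dots> = (E 0 + \<beta> * (Q + q n)) * exp (\<alpha> * (Q + q n))"
    by (simp add: distrib_left exp_add algebra_simps)
  finally show ?case by (simp add: Q_def)
qed (use nonneg in simp)

text \<open>Abel summation for the nonnegative numbers \<open>a k - A\<close>: the terms with
  \<open>w (Suc k) - w k\<close> are nonpositive. The boundary term at \<open>n\<close> is kept
  because the induction needs it.\<close>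

lemma antimono_weighted_telescope_le:
  fixes w a :: "nat \<Rightarrow> real"
  assumes w: "antimono w" and a: "\<And>k. A \<le> a k"
  shows "(\<Sum>k<n. w k * (a k - a (Suc k))) \<le> w 0 * (a 0 - A) - w n * (a n - A)"
proof (induction n)
  case (Suc n)
  have "w (Suc n) * (a (Suc n) - A) \<le> w n * (a (Suc n) - A)"
    using antimonoD[OF w, of n "Suc n"] a[of "Suc n"] by (intro mult_right_mono) simp_all
  then show ?case using Suc by (simp add: algebra_simps)
qed simp

section \<open>Arithmetic of constant step sizes\<close>

lemma sqrt_ratio:
  assumes "0 < \<delta>" "0 < \<rho>" "0 < B" "0 < (K::real)"
  shows "\<delta> / (K * sqrt (\<delta> / (\<rho> * B * K))) = sqrt (B * \<rho> * \<delta> / K)"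
proof -
  have "sqrt (B * \<rho> * \<delta> / K) * sqrt (\<delta> / (\<rho> * B * K)) = sqrt ((\<delta> / K)\<^sup>2)"
    unfolding real_sqrt_mult[symmetric] using assms by (simp add: field_simps power2_eq_square)
  also have "\<dots> = \<delta> / K" using assms by simp
  finally show ?thesis using assms by (simp add: field_simps)
qed

text \<open>Here \<open>B\<close> stands for a squared subgradient bound and \<open>q\<close> for
  \<open>1 - lam * \<rho>r\<close>. The cap on \<open>T\<close> makes the error sum at most
  \<open>\<delta>\<close>, so the numerator is at most \<open>2 * \<delta>\<close>;
  \<open>1 - lam * \<rho> = 1/2\<close> doubles this to 4.\<close>

lemma constant_step_rate:
  fixes K :: nat
  assumes pos: "0 < \<delta>" "0 < \<rho>" "0 < B" "1/2 \<le> q" "0 < T" "0 < K"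
    and lam: "lam = 1 / (2 * \<rho>)" and E: "E \<le> \<delta>"
    and T: "T \<le> q * sqrt (\<delta> / (\<rho> * B * real K))"
    and M: "M \<le> (E + B / (2 * lam * q\<^sup>2) * (\<Sum>k=0..K-1. T\<^sup>2)) / ((1 - lam * \<rho>) * (\<Sum>k=0..K-1. T))"
  shows "M \<le> 4 * (\<delta> / (real K * T))"
proof -
  have T2: "T\<^sup>2 \<le> q\<^sup>2 * (\<delta> / (\<rho> * B * real K))"
  proof -
    have "T\<^sup>2 \<le> (q * sqrt (\<delta> / (\<rho> * B * real K)))\<^sup>2" using T pos by (intro power_mono) simp_all
    also have "\<dots> = q\<^sup>2 * (\<delta> / (\<rho> * B * real K))" using pos by (simp add: power_mult_distrib)
    finally show ?thesis .
  qed
  have sums: "(\<Sum>k=0..K-1. T\<^sup>2) = real K * T\<^sup>2" "(\<Sum>k=0..K-1. T) = real K * T" using pos by simp_all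
  have "B / (2 * lam * q\<^sup>2) = \<rho> * B / q\<^sup>2" using pos lam by simp
  then have "B / (2 * lam * q\<^sup>2) * (real K * T\<^sup>2) \<le> \<rho> * B / q\<^sup>2 * (real K * (q\<^sup>2 * (\<delta> / (\<rho> * B * real K))))"
    using T2 pos by (simp only:) (intro mult_left_mono; simp)
  also have "\<dots> = \<delta>" using pos by (simp add: field_simps)
  finally have num: "E + B / (2 * lam * q\<^sup>2) * (real K * T\<^sup>2) \<le> 2 * \<delta>" using E by simp
  have lr: "1 - lam * \<rho> = 1/2" using lam pos by simp
  note M[unfolded sums lr]
  also have "(E + B / (2 * lam * q\<^sup>2) * (real K * T\<^sup>2)) / (1/2 * (real K * T)) \<le> 2 * \<delta> / (1/2 * (real K * T))"
    using num pos by (intro divide_right_mono) simp_all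
  also have "\<dots> = 4 * (\<delta> / (real K * T))" by simp
  finally show ?thesis .
qed

text \<open>The bound \<open>1/2 \<le> q\<close> costs a factor 2, which turns the 4 of
  \<open>constant_step_rate\<close> into the 8 of the final rates.\<close>

lemma step_scale_bound:
  assumes "0 < \<delta>" "0 < \<rho>" "0 < B" "0 < (K::real)" "1/2 \<le> q"
  shows "4 * (\<delta> / (K * (q * sqrt (\<delta> / (\<rho> * B * K))))) \<le> 8 * sqrt (B * \<rho> * \<delta> / K)"
proof -
  have "\<delta> / (K * (q * sqrt (\<delta> / (\<rho> * B * K)))) = 1 / q * (\<delta> / (K * sqrt (\<delta> / (\<rho> * B * K))))"
    by (simp add: mult_ac)
  also have "\<dots> \<le> 2 * (\<delta> / (K * sqrt (\<delta> / (\<rho> * B * K))))"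
    using assms by (intro mult_right_mono) (simp_all add: field_simps)
  also have "\<dots> = 2 * sqrt (B * \<rho> * \<delta> / K)"
    using assms by (simp only: sqrt_ratio)
  finally show ?thesis by simp
qed

text \<open>Cancelling \<open>\<kappa> = 1 - T * \<sigma>\<close> leaves three summands in the
  numerator, each at most \<open>\<delta>\<close>: the first by \<open>\<kappa> \<le> 1\<close>, the
  second by \<open>T \<le> lam\<close>, the third by the square-root cap on \<open>T\<close>. The
  factor 1/2 in the denominator makes this 6.\<close>

lemma constant_step_rate_Lipschitz:
  fixes K :: nat
  assumes pos: "0 < \<delta>" "0 < \<rho>" "0 < L" "0 < T" "0 < K" "0 \<le> \<sigma>" "\<sigma> \<le> \<rho>"
    and lam: "lam = 1 / (2 * \<rho>)" and E: "0 \<le> E" "E \<le> \<delta>" "\<Delta> \<le> \<delta>"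
    and T: "T \<le> lam" "T \<le> 1 / (2 * L) * sqrt (\<delta> / (\<rho> * real K))"
    and M: "M \<le> (E + T / (lam * (1 - T * \<sigma>)) * \<Delta> + 2 * L\<^sup>2 / lam * (\<Sum>k=0..K-1. T\<^sup>2 / (1 - T * \<sigma>)))
      / ((1 - lam * \<rho>) * (\<Sum>k=0..K-1. T / (1 - T * \<sigma>)))"
  shows "M \<le> 6 * (\<delta> / (real K * T))"
proof -
  define \<kappa> where "\<kappa> = 1 - T * \<sigma>"
  have "T * \<sigma> \<le> lam * \<rho>" using T pos lam by (intro mult_mono) simp_all
  then have \<kappa>: "0 < \<kappa>" "\<kappa> \<le> 1" unfolding \<kappa>_def using pos lam by simp_all
  have lam_pos: "0 < lam" using lam pos by simp
  have T2: "T\<^sup>2 \<le> 1 / (4 * L\<^sup>2) * (\<delta> / (\<rho> * real K))"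
  proof -
    have "T\<^sup>2 \<le> (1 / (2 * L) * sqrt (\<delta> / (\<rho> * real K)))\<^sup>2" using T pos by (intro power_mono) simp_all
    also have "\<dots> = 1 / (4 * L\<^sup>2) * (\<delta> / (\<rho> * real K))" using pos by (simp add: power_mult_distrib power_divide)
    finally show ?thesis .
  qed
  have "2 * L\<^sup>2 / lam * (real K * T\<^sup>2) \<le> 2 * L\<^sup>2 / lam * (real K * (1 / (4 * L\<^sup>2) * (\<delta> / (\<rho> * real K))))"
    using T2 lam_pos by (intro mult_left_mono) simp_all
  also have "\<dots> = \<delta>" using pos lam by (simp add: field_simps)
  finally have 3: "2 * L\<^sup>2 / lam * (real K * T\<^sup>2) \<le> \<delta>" .
  have "T / lam * \<Delta> \<le> T / lam * \<delta>" using E pos lam_pos by (intro mult_left_mono) simp_all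
  also have "\<dots> \<le> 1 * \<delta>" using T lam_pos pos by (intro mult_right_mono) simp_all
  finally have 2: "T / lam * \<Delta> \<le> \<delta>" by simp
  have 1: "\<kappa> * E \<le> \<delta>" using \<kappa> E mult_right_mono[of \<kappa> 1 E] by simp
  have sums: "(\<Sum>k=0..K-1. T\<^sup>2 / \<kappa>) = real K * T\<^sup>2 / \<kappa>" "(\<Sum>k=0..K-1. T / \<kappa>) = real K * T / \<kappa>"
    using pos by simp_all
  have lr: "1 - lam * \<rho> = 1/2" using lam pos by simp
  note M[folded \<kappa>_def, unfolded sums lr]
  also have "(E + T / (lam * \<kappa>) * \<Delta> + 2 * L\<^sup>2 / lam * (real K * T\<^sup>2 / \<kappa>)) / (1/2 * (real K * T / \<kappa>))
      = (\<kappa> * E + T / lam * \<Delta> + 2 * L\<^sup>2 / lam * (real K * T\<^sup>2)) / (1/2 * (real K * T))"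
    using \<kappa> pos lam_pos by (simp add: field_simps)
  also have "\<dots> \<le> 3 * \<delta> / (1/2 * (real K * T))"
    using 1 2 3 pos by (intro divide_right_mono) simp_all
  also have "\<dots> = 6 * (\<delta> / (real K * T))" by simp
  finally show ?thesis .
qed

section \<open>Bregman distances and proximal points\<close>

locale bregman_kernel =
  fixes \<omega> :: "'a::euclidean_space \<Rightarrow> real"
  assumes C1: "continuously_differentiable \<omega>" and strongly_convex: "strongly_convex_1 \<omega>"
begin

abbreviation D :: "'a \<Rightarrow> 'a \<Rightarrow> real" where "D \<equiv> bregman \<omega>"
abbreviation G :: "'a \<Rightarrow> 'a" where "G \<equiv> nabla \<omega>"

text \<open>Uniqueness of gradients identifies the definite description behind \<open>nabla\<close>
  with the continuous gradient field given by \<open>C1\<close>.\<close>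

lemma nabla: "GDERIV \<omega> x :> G x" and continuous_nabla: "continuous_on UNIV G"
proof -
  obtain G' where G': "\<And>x. GDERIV \<omega> x :> G' x" "continuous_on UNIV G'"
    using C1 unfolding continuously_differentiable_def by blast
  have "G x = G' x" for x
    unfolding nabla_def using G'(1) GDERIV_unique by blast
  then have "G = G'" by blast
  then show "GDERIV \<omega> x :> G x" "continuous_on UNIV G" using G' by simp_all
qed

lemma continuous_kernel: "continuous_on UNIV \<omega>"
  using nabla unfolding gderiv_def
  by (meson continuous_at_imp_continuous_on has_derivative_continuous)

lemma continuous_bregman:
  assumes "continuous_on S f" "continuous_on S h"
  shows "continuous_on S (\<lambda>y. D (f y) (h y))"
  unfolding bregman_def
  by (intro continuous_intros assms continuous_on_compose2[OF continuous_kernel]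
      continuous_on_compose2[OF continuous_nabla]) auto

text \<open>Gradient inequality for the convex function \<open>h\<close>, whose gradient at
  \<open>x\<close> is \<open>G x - x\<close>: its difference quotients towards \<open>y\<close> stay
  below \<open>h y - h x\<close>, and so does their limit. The subtracted quadratic contributes
  exactly half the squared distance.\<close>

lemma bregman_ge_norm: "1/2 * (norm (y - x))\<^sup>2 \<le> D y x"
proof -
  define h where "h = (\<lambda>x. \<omega> x - 1 / 2 * (norm x)\<^sup>2)"
  have cv: "convex_on UNIV h" using strongly_convex unfolding strongly_convex_1_def h_def .
  have "((\<lambda>y. 1/2 * (y \<bullet> y)) has_derivative (\<lambda>v. v \<bullet> x)) (at x)"
    by (auto intro!: derivative_eq_intros simp: inner_commute)
  then have "GDERIV h x :> G x - x"
    unfolding h_def power2_norm_eq_inner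
    by (intro GDERIV_diff nabla) (simp add: gderiv_def)
  from GDERIV_directional[OF this]
  have lim: "((\<lambda>s. (h (x + s *\<^sub>R (y - x)) - h x) / s) \<longlongrightarrow> (G x - x) \<bullet> (y - x)) (at_right 0)" .
  have "(h (x + s *\<^sub>R (y - x)) - h x) / s \<le> h y - h x" if "0 < s" "s < 1" for s
  proof -
    have "h (x + s *\<^sub>R (y - x)) \<le> (1 - s) * h x + s * h y"
      using convex_onD[OF cv, of s x y] that by (simp add: algebra_simps)
    then show ?thesis using that by (simp add: field_simps)
  qed
  then have "\<forall>\<^sub>F s in at_right 0. (h (x + s *\<^sub>R (y - x)) - h x) / s \<le> h y - h x"
    by (intro eventually_at_rightI[of 0 1]) auto
  from tendsto_upperbound[OF lim this]
  have "(G x - x) \<bullet> (y - x) \<le> h y - h x" by simp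
  then show ?thesis
    unfolding h_def bregman_def power2_norm_eq_inner
    by (simp add: inner_diff_left inner_diff_right inner_commute field_simps)
qed

lemma bregman_nonneg: "0 \<le> D y x"
  using bregman_ge_norm[of y x] by (smt (verit) zero_le_power2 mult_nonneg_nonneg divide_nonneg_nonneg)

lemma bregman_sym: "D y x + D x y = (G y - G x) \<bullet> (y - x)"
  by (simp add: bregman_def inner_diff_left inner_diff_right)

lemma bregman_three_points: "D z x = D z y + D y x + (G y - G x) \<bullet> (z - y)"
  by (simp add: bregman_def inner_diff_left inner_diff_right)

text \<open>Strong monotonicity of \<open>G\<close> and Cauchy-Schwarz. It converts a bound on the
  subgradient \<open>(1 / lam) *\<^sub>R (G z - G p)\<close> of a proximal point \<open>p\<close>
  into a bound on \<open>norm (p - z)\<close>.\<close>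

lemma norm_le_norm_nabla_diff: "norm (y - x) \<le> norm (G y - G x)"
proof -
  have "norm (y - x) * norm (y - x) \<le> norm (G y - G x) * norm (y - x)"
    using bregman_ge_norm[of y x] bregman_ge_norm[of x y] bregman_sym[of y x]
      norm_cauchy_schwarz[of "G y - G x" "y - x"]
    by (simp add: norm_minus_commute power2_eq_square)
  then show ?thesis by (cases "norm (y - x) = 0") (simp, simp only: mult_le_cancel_right, auto)
qed

section \<open>First-order optimality and existence of proximal points\<close>

lemma GDERIV_bregman_left: "GDERIV (\<lambda>y. D y x) y :> G y - G x"
proof -
  have "(D' has_derivative (\<lambda>h. h \<bullet> (G y - G x))) (at y)" if "D' = (\<lambda>y. D y x)" for D'
    unfolding that bregman_def
    using nabla[of y, unfolded gderiv_def]
    by (auto intro!: derivative_eq_intros simp: inner_diff_right inner_commute)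
  then show ?thesis unfolding gderiv_def by blast
qed

text \<open>Fermat's rule along segments: minimality at \<open>p\<close> is compared with the
  convexity bound for \<open>\<phi>\<close> at \<open>q s\<close>, divided by \<open>s\<close>, and
  \<open>s\<close> tends to 0 from the right. The limits of the quotients of \<open>\<psi>\<close>
  and \<open>\<omega>\<close> complete the expression to \<open>D y p\<close>.\<close>

lemma argmin_imp_rel_subdiff:
  assumes cv: "rel_weakly_convex \<rho> \<omega> \<phi>"
    and fin: "\<phi> p = ereal a" and nm: "\<And>y. \<phi> y \<noteq> -\<infinity>"
    and \<psi>: "GDERIV \<psi> p :> v"
    and min: "\<And>y. \<phi> p + ereal (\<psi> p) \<le> \<phi> y + ereal (\<psi> y)"
  shows "- v \<in> rel_subdiff \<rho> \<omega> \<phi> p"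
  unfolding rel_subdiff_iff
proof (intro conjI allI)
  fix y
  show "\<phi> p + ereal (- v \<bullet> (y - p) - \<rho> * D y p) \<le> \<phi> y"
  proof (cases "\<phi> y")
    case (real b)
    define q where "q = (\<lambda>s. p + s *\<^sub>R (y - p))"
    have "a - b - \<rho> * (\<omega> y - \<omega> p) \<le> (\<psi> (q s) - \<psi> p) / s - \<rho> * ((\<omega> (q s) - \<omega> p) / s)"
      if s: "0 < s" "s < 1" for s
    proof -
      have "q s = (1 - s) *\<^sub>R p + s *\<^sub>R y" unfolding q_def by (simp add: algebra_simps)
      then have "\<phi> (q s) \<le> ereal ((1 - s) * a + s * b + \<rho> * ((1 - s) * \<omega> p + s * \<omega> y - \<omega> (q s)))"
        using rel_weakly_convexD[OF cv fin real, of "1 - s" s] s by simp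
      then have "a + \<psi> p \<le> (1 - s) * a + s * b + \<rho> * ((1 - s) * \<omega> p + s * \<omega> y - \<omega> (q s)) + \<psi> (q s)"
        using min[of "q s"] fin nm[of "q s"] by (cases "\<phi> (q s)") auto
      then have "s * (a - b - \<rho> * (\<omega> y - \<omega> p)) \<le> (\<psi> (q s) - \<psi> p) - \<rho> * (\<omega> (q s) - \<omega> p)"
        by (simp add: algebra_simps)
      then have "a - b - \<rho> * (\<omega> y - \<omega> p) \<le> ((\<psi> (q s) - \<psi> p) - \<rho> * (\<omega> (q s) - \<omega> p)) / s"
        using s by (simp add: pos_le_divide_eq mult.commute)
      then show ?thesis 
        by (simp only: diff_divide_distrib[of "\<psi> (q s) - \<psi> p" "\<rho> * (\<omega> (q s) - \<omega> p)"] times_divide_eq_right)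
    qed
    then have ev: "\<forall>\<^sub>F s in at_right 0. a - b - \<rho> * (\<omega> y - \<omega> p)
        \<le> (\<psi> (q s) - \<psi> p) / s - \<rho> * ((\<omega> (q s) - \<omega> p) / s)"
      by (intro eventually_at_rightI[of 0 1]) auto
    have "((\<lambda>s. (\<psi> (q s) - \<psi> p) / s - \<rho> * ((\<omega> (q s) - \<omega> p) / s)) \<longlongrightarrow>
        v \<bullet> (y - p) - \<rho> * (G p \<bullet> (y - p))) (at_right 0)"
      unfolding q_def by (intro tendsto_intros GDERIV_directional \<psi> nabla)
    from tendsto_lowerbound[OF this ev] show ?thesis
      using fin real by (simp add: bregman_def algebra_simps)
  qed (use fin nm[of y] in auto)
qed (use fin in auto)

lemma prox_subgradient:
  assumes cv: "rel_weakly_convex \<rho> \<omega> \<phi>"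
    and fin: "\<phi> p = ereal a" and nm: "\<And>y. \<phi> y \<noteq> -\<infinity>"
    and min: "\<And>y. \<phi> p + ereal (1 / lam * D p z) \<le> \<phi> y + ereal (1 / lam * D y z)"
  shows "(1 / lam) *\<^sub>R (G z - G p) \<in> rel_subdiff \<rho> \<omega> \<phi> p"
proof -
  have "GDERIV (\<lambda>y. 1 / lam * D y z) p :> (1 / lam) *\<^sub>R (G p - G z)"
    using has_derivative_mult_right[OF GDERIV_bregman_left[of z p, unfolded gderiv_def], of "1/lam"]
    by (simp add: gderiv_def)
  from argmin_imp_rel_subdiff[OF cv fin nm this min] show ?thesis
    by (simp add: algebra_simps)
qed

text \<open>Coercivity: the minorant leaves \<open>(1 / lam - \<rho>) * D y z\<close>, which grows
  quadratically and beats the linear term, so a minimum over a large ball is global.\<close>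

lemma prox_exists:
  assumes lsc: "lower_semicont \<phi>" and nm: "\<And>y. \<phi> y \<noteq> -\<infinity>" and fin: "\<phi> y0 = ereal b0"
    and minor: "\<And>y. ereal (c + a \<bullet> (y - z) - \<rho> * D y z) \<le> \<phi> y"
    and lam: "0 < lam" "lam * \<rho> < 1"
  obtains p b where "\<phi> p = ereal b" "\<And>y. \<phi> p + ereal (1 / lam * D p z) \<le> \<phi> y + ereal (1 / lam * D y z)"
proof -
  define \<Phi> where "\<Phi> = (\<lambda>y. \<phi> y + ereal (1 / lam * D y z))"
  define \<kappa> where "\<kappa> = (1 / lam - \<rho>) / 2"
  define v0 where "v0 = b0 + 1 / lam * D y0 z"
  \<comment> \<open>For \<open>n > R\<close>, \<open>\<kappa> * n\<close> exceeds
    \<open>\<bar>v0 - c\<bar> + norm a\<close>; the halving in \<open>\<kappa>\<close> matches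
    \<open>D y z \<ge> n\<^sup>2 / 2\<close>. The summand 1 forces \<open>n \<ge> 1\<close>, so the
    constant may be multiplied by \<open>n\<close>.\<close>
  define R where "R = 1 + (\<bar>v0 - c\<bar> + norm a) / \<kappa>"
  have \<kappa>: "0 < \<kappa>" unfolding \<kappa>_def using lam by (simp add: field_simps)
  have R1: "1 \<le> R" unfolding R_def using \<kappa> by simp
  have lsc': "lower_semicont \<Phi>" unfolding \<Phi>_def
    by (intro lower_semicont_add lsc nm lower_semicont_continuous continuous_intros continuous_bregman) simp_all
  have v0: "\<Phi> y0 = ereal v0" unfolding \<Phi>_def v0_def using fin by simp
  have out: "ereal v0 < \<Phi> y" if y: "R < norm (y - z)" for y
  proof -
    define n where "n = norm (y - z)"
    have n: "1 \<le> n" "R < n" using y R1 unfolding n_def by simp_all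
    have "\<bar>v0 - c\<bar> + norm a < \<kappa> * n"
    proof -
      have "(\<bar>v0 - c\<bar> + norm a) / \<kappa> < n" using n unfolding R_def by simp
      then show ?thesis using \<kappa> by (simp add: field_simps)
    qed
    then have "(\<bar>v0 - c\<bar> + norm a) * n < \<kappa> * n * n"
      using n by (intro mult_strict_right_mono) simp_all
    moreover have "\<bar>v0 - c\<bar> \<le> \<bar>v0 - c\<bar> * n" using n by (simp add: mult_le_cancel_left1)
    ultimately have "v0 < c - norm a * n + \<kappa> * n * n" by (simp add: algebra_simps)
    also have "\<dots> \<le> c + a \<bullet> (y - z) + (1 / lam - \<rho>) * D y z"
    proof -
      have "\<kappa> * n\<^sup>2 \<le> \<kappa> * (2 * D y z)"
        using bregman_ge_norm[of y z] \<kappa> unfolding n_def by (intro mult_left_mono) simp_all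
      then have "\<kappa> * n * n \<le> 2 * \<kappa> * D y z" by (simp add: power2_eq_square mult_ac)
      moreover have "1 / lam - \<rho> = 2 * \<kappa>" unfolding \<kappa>_def by simp
      moreover have "- (norm a * n) \<le> a \<bullet> (y - z)"
        using Cauchy_Schwarz_ineq2[of a "y - z"] unfolding n_def by simp
      ultimately show ?thesis by simp
    qed
    also have "\<dots> = (c + a \<bullet> (y - z) - \<rho> * D y z) + 1 / lam * D y z" by (simp add: algebra_simps)
    finally have "ereal v0 < ereal (c + a \<bullet> (y - z) - \<rho> * D y z) + ereal (1 / lam * D y z)" by simp
    also have "\<dots> \<le> \<Phi> y" unfolding \<Phi>_def by (intro add_right_mono minor)
    finally show ?thesis .
  qed
  have y0: "y0 \<in> cball z R" using out[of y0] v0 by (force simp: dist_norm norm_minus_commute not_less)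
  obtain p where p: "p \<in> cball z R" "\<And>y. y \<in> cball z R \<Longrightarrow> \<Phi> p \<le> \<Phi> y"
    using lower_semicont_attains_min[OF lsc' compact_cball, of z R] y0 by blast
  have pv: "\<Phi> p \<le> ereal v0" using p(2)[OF y0] v0 by simp
  have "\<Phi> p \<le> \<Phi> y" for y
  proof (cases "y \<in> cball z R")
    case False
    then show ?thesis using out[of y] pv by (simp add: dist_norm norm_minus_commute)
  qed (rule p(2))
  moreover obtain b where "\<phi> p = ereal b"
    using pv nm[of p] unfolding \<Phi>_def by (cases "\<phi> p") auto
  ultimately show ?thesis using that unfolding \<Phi>_def by blast
qed

text \<open>Proximal points of \<open>z\<close> with parameter tending to \<open>0\<close> carry bounded subgradients, so they
  converge to \<open>z\<close>, and the subgradient inequalities at these points pass to the limit by lower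
  semicontinuity.  In particular \<open>\<phi> z\<close> is finite, even if \<open>z\<close> is not assumed to lie in the domain.\<close>

lemma bounded_subdiff_imp_increment_bound:
  fixes m :: "'a \<Rightarrow> real"
  assumes cv: "rel_weakly_convex \<rho> \<omega> \<phi>" and lsc: "lower_semicont \<phi>"
    and nm: "\<And>y. \<phi> y \<noteq> -\<infinity>" and \<rho>: "0 < \<rho>"
    and minor: "\<And>y. ereal (c + a \<bullet> (y - z) - \<rho> * D y z) \<le> \<phi> y"
    and m: "continuous_on UNIV m"
    and sub: "\<And>p v. v \<in> rel_subdiff \<rho> \<omega> \<phi> p \<Longrightarrow> norm v \<le> m p"
  shows "\<phi> z \<le> \<phi> y + ereal (m z * norm (y - z) + \<rho> * D y z)"
proof (cases "\<phi> y")
  case (real b)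
  \<comment> \<open>The factor keeps \<open>lam n \<le> 1\<close> and
    \<open>lam n * \<rho> \<le> 1/2\<close> for every \<open>n\<close>; the latter preserves half of
    \<open>D (p n) z\<close> once the minorant has consumed its share.\<close>
  define lam where "lam = (\<lambda>n. 1 / (2 * \<rho> + 1) / real (Suc n))"
  have lam: "0 < lam n" "lam n \<le> 1" "lam n * \<rho> \<le> 1/2" for n
  proof -
    show "0 < lam n" using \<rho> unfolding lam_def by simp
    have "1 / (2 * \<rho> + 1) / real (Suc n) \<le> 1 / (2 * \<rho> + 1) / 1"
      using \<rho> by (intro divide_left_mono) simp_all
    then have "lam n \<le> 1 / (2 * \<rho> + 1)" unfolding lam_def by simp
    moreover have "1 / (2 * \<rho> + 1) \<le> 1" "1 / (2 * \<rho> + 1) * \<rho> \<le> 1/2" using \<rho> by (simp_all add: field_simps)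
    ultimately show "lam n \<le> 1" "lam n * \<rho> \<le> 1/2"
      using \<rho> mult_right_mono[of "lam n" "1 / (2 * \<rho> + 1)" \<rho>] by linarith+
  qed
  have "lam \<longlonglongrightarrow> 1 / (2 * \<rho> + 1) * 0"
    unfolding lam_def divide_inverse[of _ "real (Suc _)"]
    by (intro tendsto_mult tendsto_const LIMSEQ_inverse_real_of_nat)
  then have lam0: "lam \<longlonglongrightarrow> 0" by simp
  have "\<exists>p q. \<phi> p = ereal q \<and>
      (\<forall>y. \<phi> p + ereal (1 / lam n * D p z) \<le> \<phi> y + ereal (1 / lam n * D y z))" for n
  proof -
    have "lam n * \<rho> < 1" using lam(3)[of n] by simp
    from prox_exists[OF lsc nm real minor lam(1) this] show ?thesis by blast
  qed
  then obtain p q where pq: "\<And>n. \<phi> (p n) = ereal (q n)"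
    and min: "\<And>n y. \<phi> (p n) + ereal (1 / lam n * D (p n) z) \<le> \<phi> y + ereal (1 / lam n * D y z)"
    by metis
  have v: "(1 / lam n) *\<^sub>R (G z - G (p n)) \<in> rel_subdiff \<rho> \<omega> \<phi> (p n)" for n
    using prox_subgradient[OF cv pq nm min] .
  \<comment> \<open>As \<open>m\<close> is merely continuous, it is bounded only on balls, so the
    points \<open>p n\<close> must first be confined. Comparison with \<open>y\<close> and the
    minorant give \<open>N * N / 4\<close> at most a multiple of \<open>N\<close> for
    \<open>N > 1\<close>; the leading 1 covers \<open>N \<le> 1\<close>.\<close>
  define R where "R = 1 + 4 * (\<bar>b - c\<bar> + D y z + norm a)"
  have R: "norm (p n - z) \<le> R" for n
  proof (cases "norm (p n - z) \<le> 1")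
    case True
    have "0 \<le> \<bar>b - c\<bar> + D y z + norm a"
      by (intro add_nonneg_nonneg abs_ge_zero bregman_nonneg norm_ge_zero)
    then have "1 \<le> R" unfolding R_def by simp
    with True show ?thesis by (rule order_trans)
  next
    case False
    define N where "N = norm (p n - z)"
    define L where "L = lam n"
    have N: "1 < N" using False unfolding N_def by simp
    have L: "0 < L" "L \<le> 1" "L * \<rho> \<le> 1/2" using lam unfolding L_def by simp_all
    have "q n + 1 / L * D (p n) z \<le> b + 1 / L * D y z"
      using min[of n y] pq[of n] real unfolding L_def by simp
    then have "L * (q n + 1 / L * D (p n) z) \<le> L * (b + 1 / L * D y z)"
      using L by (intro mult_left_mono) simp_all
    then have 1: "L * q n + D (p n) z \<le> L * b + D y z" using L by (simp add: algebra_simps)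
    have "c + a \<bullet> (p n - z) - \<rho> * D (p n) z \<le> q n" using minor[of "p n"] pq[of n] by simp
    then have "L * (c + a \<bullet> (p n - z) - \<rho> * D (p n) z) \<le> L * q n"
      using L by (intro mult_left_mono) simp_all
    then have 2: "L * c + L * (a \<bullet> (p n - z)) - L * \<rho> * D (p n) z \<le> L * q n"
      by (simp add: algebra_simps)
    have 3: "L * \<rho> * D (p n) z \<le> 1/2 * D (p n) z"
      using L bregman_nonneg by (intro mult_right_mono) simp_all
    have "- (a \<bullet> (p n - z)) \<le> norm a * N"
      using Cauchy_Schwarz_ineq2[of a "p n - z"] unfolding N_def by simp
    then have "L * (- (a \<bullet> (p n - z))) \<le> L * (norm a * N)" using L by (intro mult_left_mono) simp_all
    also have "\<dots> \<le> 1 * (norm a * N)" using L N by (intro mult_right_mono) simp_all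
    finally have 4: "- (L * (a \<bullet> (p n - z))) \<le> norm a * N" by simp
    have "L * (b - c) \<le> L * \<bar>b - c\<bar>" using L by (intro mult_left_mono) simp_all
    also have "\<dots> \<le> 1 * \<bar>b - c\<bar>" using L by (intro mult_right_mono) simp_all
    finally have 5: "L * b - L * c \<le> \<bar>b - c\<bar>" by (simp add: algebra_simps)
    have "1/4 * (N * N) \<le> 1/2 * D (p n) z"
      using bregman_ge_norm[of "p n" z] unfolding N_def power2_eq_square by simp
    also have "\<dots> \<le> \<bar>b - c\<bar> + D y z + norm a * N" using 1 2 3 4 5 by linarith
    also have "\<dots> \<le> (\<bar>b - c\<bar> + D y z + norm a) * N"
    proof -
      have "(\<bar>b - c\<bar> + D y z) * 1 \<le> (\<bar>b - c\<bar> + D y z) * N"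
        using N bregman_nonneg[of y z] by (intro mult_left_mono) simp_all
      then show ?thesis by (simp add: algebra_simps)
    qed
    finally have "N * N \<le> (4 * (\<bar>b - c\<bar> + D y z + norm a)) * N" by (simp add: algebra_simps)
    then have "N \<le> 4 * (\<bar>b - c\<bar> + D y z + norm a)"
      by (rule mult_right_le_imp_le) (use N in simp)
    then show ?thesis unfolding R_def N_def by simp
  qed
  have "continuous_on (cball z R) m" by (rule continuous_on_subset[OF m]) simp
  then have "bounded (m ` cball z R)"
    by (intro compact_imp_bounded compact_continuous_image compact_cball)
  then obtain M where M: "\<And>x. x \<in> cball z R \<Longrightarrow> norm (m x) \<le> M"
    unfolding bounded_iff by blast
  \<comment> \<open>\<open>G z - G (p n)\<close> is \<open>lam n\<close> times a subgradient, and
    its norm dominates the distance of the points.\<close>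
  have dist_p: "norm (p n - z) \<le> lam n * M" for n
  proof -
    have "norm (p n - z) \<le> norm (G z - G (p n))"
      using norm_le_norm_nabla_diff[of "p n" z] by (simp add: norm_minus_commute)
    also have "\<dots> = lam n * norm ((1 / lam n) *\<^sub>R (G z - G (p n)))" using lam(1)[of n] by simp
    also have "\<dots> \<le> lam n * m (p n)"
      using sub[OF v[of n]] lam(1)[of n] by (intro mult_left_mono) simp_all
    also have "\<dots> \<le> lam n * M"
      using M[of "p n"] R[of n] lam(1)[of n]
      by (intro mult_left_mono) (auto simp: dist_norm norm_minus_commute)
    finally show ?thesis .
  qed
  have "(\<lambda>n. lam n * M) \<longlonglongrightarrow> 0 * M" by (intro tendsto_intros lam0)
  then have "(\<lambda>n. p n - z) \<longlonglongrightarrow> 0"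
    using dist_p by (intro Lim_null_comparison[of "\<lambda>n. p n - z" "\<lambda>n. lam n * M"] always_eventually) auto
  then have p: "p \<longlonglongrightarrow> z" by (simp add: LIM_zero_iff)
  have q: "q n \<le> b + m (p n) * norm (y - p n) + \<rho> * D y (p n)" for n
  proof -
    have "q n + (((1 / lam n) *\<^sub>R (G z - G (p n))) \<bullet> (y - p n) - \<rho> * D y (p n)) \<le> b"
      using v[of n, unfolded rel_subdiff_iff, THEN conjunct2, rule_format, of y]
      unfolding pq real by simp
    moreover have "- (((1 / lam n) *\<^sub>R (G z - G (p n))) \<bullet> (y - p n)) \<le> m (p n) * norm (y - p n)"
      using Cauchy_Schwarz_ineq2[of "(1 / lam n) *\<^sub>R (G z - G (p n))" "y - p n"]
        mult_right_mono[OF sub[OF v[of n]], of "norm (y - p n)", OF norm_ge_zero]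
      by linarith
    ultimately show ?thesis by simp
  qed
  have "continuous_on UNIV (\<lambda>u. b + m u * norm (y - u) + \<rho> * D y u)"
    by (intro continuous_intros m continuous_bregman)
  then have lim: "(\<lambda>n. b + m (p n) * norm (y - p n) + \<rho> * D y (p n)) \<longlonglongrightarrow>
      b + m z * norm (y - z) + \<rho> * D y z"
    using p by (intro continuous_on_tendsto_compose[of UNIV "\<lambda>u. b + m u * norm (y - u) + \<rho> * D y u"]) simp_all
  show ?thesis
  \<comment> \<open>Arguing by contradiction treats \<open>\<phi> z = \<infinity>\<close> together
    with finite values: semicontinuity would lift \<open>q n\<close> above \<open>c'\<close>, while
    its upper bounds converge to a number below \<open>c'\<close>.\<close>
  proof (rule ccontr)
    assume "\<not> ?thesis"
    then have "ereal (b + m z * norm (y - z) + \<rho> * D y z) < \<phi> z" using real by (simp add: not_le add.assoc)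
    then obtain c' where c': "b + m z * norm (y - z) + \<rho> * D y z < c'" "ereal c' < \<phi> z"
      using ereal_dense2 by force
    have "\<forall>\<^sub>F n in sequentially. ereal c' < \<phi> (p n)"
      by (rule eventually_compose_filterlim[OF lsc[unfolded lower_semicont_iff, rule_format, OF c'(2)] p])
    moreover have "\<forall>\<^sub>F n in sequentially. b + m (p n) * norm (y - p n) + \<rho> * D y (p n) < c'"
      using order_tendstoD(2)[OF lim c'(1)] .
    ultimately have "\<forall>\<^sub>F n in sequentially. False"
    proof eventually_elim
      case (elim n)
      then show ?case using q[of n] pq[of n] by simp
    qed
    then show False by simp
  qed
qed (use nm[of y] in auto)

text \<open>Subdivide the segment into \<open>n\<close> pieces: the symmetrised Bregman distances of consecutive points
  telescope to \<open>O(1 / n)\<close>.\<close>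

lemma bounded_subdiff_imp_Lipschitz:
  assumes incr: "\<And>y z. \<phi> z \<le> \<phi> y + L * norm (y - z) + \<rho> * D y z" and \<rho>: "0 \<le> \<rho>"
  shows "\<phi> z \<le> \<phi> y + L * norm (y - z)"
proof -
  define d where "d = z - y"
  have est: "\<phi> z \<le> \<phi> y + L * norm (y - z) + \<rho> * ((G z - G y) \<bullet> d) * inverse (real (Suc n))" for n
  proof -
    define N where "N = Suc n"
    define u where "u = (\<lambda>i. y + (real i / real N) *\<^sub>R d)"
    have N: "0 < real N" unfolding N_def by simp
    have step: "u (Suc i) - u i = (1 / real N) *\<^sub>R d" for i
      unfolding u_def by (simp add: add_divide_distrib scaleR_left_distrib)
    have 1: "\<phi> (u (Suc i)) - \<phi> (u i) \<le> L * norm d / real N + \<rho> / real N * ((G (u (Suc i)) - G (u i)) \<bullet> d)" for i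
    proof -
      \<comment> \<open>The nonnegative reverse distance is added because the symmetrised distance
        is linear in the gradients for the fixed direction \<open>d\<close>.\<close>
      have "D (u i) (u (Suc i)) \<le> (G (u (Suc i)) - G (u i)) \<bullet> (u (Suc i) - u i)"
        using bregman_sym[of "u (Suc i)" "u i"] bregman_nonneg[of "u (Suc i)" "u i"] by simp
      then have "\<rho> * D (u i) (u (Suc i)) \<le> \<rho> * ((G (u (Suc i)) - G (u i)) \<bullet> d / real N)"
        using \<rho> by (intro mult_left_mono) (simp_all add: step)
      moreover have "norm (u i - u (Suc i)) = norm d / real N"
        using step[of i] N norm_minus_commute[of "u i" "u (Suc i)"] by simp
      ultimately show ?thesis using incr[of "u (Suc i)" "u i"] by simp
    qed
    have "\<phi> (u N) - \<phi> (u 0) = (\<Sum>i<N. \<phi> (u (Suc i)) - \<phi> (u i))"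
      by (rule sum_lessThan_telescope[symmetric])
    also have "\<dots> \<le> (\<Sum>i<N. L * norm d / real N + \<rho> / real N * ((G (u (Suc i)) - G (u i)) \<bullet> d))"
      by (intro sum_mono 1)
    also have "\<dots> = L * norm d + \<rho> / real N * ((\<Sum>i<N. G (u (Suc i)) - G (u i)) \<bullet> d)"
      using N by (simp add: sum.distrib sum_distrib_left inner_sum_left)
    also have "(\<Sum>i<N. G (u (Suc i)) - G (u i)) = G (u N) - G (u 0)"
      by (rule sum_lessThan_telescope)
    finally have "\<phi> (u N) - \<phi> (u 0) \<le> L * norm d + \<rho> / real N * ((G (u N) - G (u 0)) \<bullet> d)" .
    moreover have "u 0 = y" "u N = z" using N unfolding u_def d_def by simp_all
    moreover have "norm d = norm (y - z)" unfolding d_def by (rule norm_minus_commute)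
    ultimately show ?thesis unfolding N_def by (simp add: divide_inverse mult_ac del: of_nat_Suc)
  qed
  have "(\<lambda>n. \<phi> y + L * norm (y - z) + \<rho> * ((G z - G y) \<bullet> d) * inverse (real (Suc n)))
      \<longlonglongrightarrow> \<phi> y + L * norm (y - z) + \<rho> * ((G z - G y) \<bullet> d) * 0"
    by (intro tendsto_intros LIMSEQ_inverse_real_of_nat)
  from LIMSEQ_le_const[OF this] est show ?thesis by force
qed

text \<open>Extrapolating from \<open>y\<close> through \<open>x\<close> to \<open>x - s (y - x)\<close> and letting \<open>s \<rightarrow> 0\<close> gives the estimate that
  a subgradient of \<open>r\<close> at \<open>x\<close> would give, without having to show that one exists.\<close>

lemma summand_increment_bound:
  fixes m :: "'a \<Rightarrow> real" and f r :: "'a \<Rightarrow> ereal"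
  assumes cvr: "rel_weakly_convex \<rho>r \<omega> r"
    and \<rho>: "0 < \<rho>f" "0 < \<rho>r"
    and fin: "\<And>y. f y = ereal (f' y)" "\<And>y. r y = ereal (r' y)"
    and g: "g \<in> rel_subdiff \<rho>f \<omega> f x"
    and m: "continuous_on UNIV m"
    and incr: "\<And>y z. f' z + r' z \<le> f' y + r' y + m z * norm (y - z) + (\<rho>f + \<rho>r) * D y z"
  shows "r' x - r' y + g \<bullet> (x - y) \<le> m x * norm (x - y) + \<rho>r * D y x"
proof -
  define d where "d = y - x"
  define q where "q = (\<lambda>s. x - s *\<^sub>R d)"
  have ev: "(r' x + \<rho>r * \<omega> x) - (r' y + \<rho>r * \<omega> y)
      \<le> m (q s) * norm d + g \<bullet> d - \<rho>r * (G x \<bullet> d) + (\<rho>f + \<rho>r) * ((G x - G (q s)) \<bullet> d)"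
    if s: "0 < s" for s
  proof -
    have fq: "f' x - s * (g \<bullet> d) - \<rho>f * D (q s) x \<le> f' (q s)"
      using g[unfolded rel_subdiff_iff, THEN conjunct2, rule_format, of "q s"]
      by (simp add: fin q_def)
    \<comment> \<open>Subtracting \<open>fq\<close> isolates an upper bound for
      \<open>r' (q s) - r' x\<close>; here control of \<open>F\<close> alone yields control of
      \<open>r\<close>.\<close>
    have Fq: "f' (q s) + r' (q s) \<le> f' x + r' x + m (q s) * (s * norm d) + (\<rho>f + \<rho>r) * D x (q s)"
      using incr[of "q s" x] s by (simp add: q_def)
    \<comment> \<open>The weights \<open>w\<close> and \<open>w * s\<close> exhibit \<open>x\<close>
      as a convex combination of \<open>q s\<close> and \<open>y\<close>.\<close>
    define w where "w = 1 / (1 + s)"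
    have w: "0 < w" "w * (1 + s) = 1" "w + w * s = 1" using s unfolding w_def by (simp_all add: field_simps)
    have "x = w *\<^sub>R q s + (w * s) *\<^sub>R y"
    proof -
      have "w *\<^sub>R q s + (w * s) *\<^sub>R y = (w * (1 + s)) *\<^sub>R x"
        unfolding q_def d_def by (simp add: algebra_simps)
      then show ?thesis using w by simp
    qed
    then have "r' x \<le> w * r' (q s) + w * s * r' y + \<rho>r * (w * \<omega> (q s) + w * s * \<omega> y - \<omega> x)"
      using rel_weakly_convexD[OF cvr fin(2)[of "q s"] fin(2)[of y], of w "w * s"] w s fin(2)[of x] by simp
    then have "r' x \<le> w * (r' (q s) + s * r' y + \<rho>r * (\<omega> (q s) + s * \<omega> y)) - \<rho>r * \<omega> x"
      by (simp add: algebra_simps)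
    then have "(1 + s) * (r' x + \<rho>r * \<omega> x) \<le> r' (q s) + s * r' y + \<rho>r * (\<omega> (q s) + s * \<omega> y)"
      using s unfolding w_def by (simp add: field_simps)
    then have "s * ((r' x + \<rho>r * \<omega> x) - (r' y + \<rho>r * \<omega> y))
        \<le> r' (q s) - r' x + \<rho>r * (\<omega> (q s) - \<omega> x)"
      by (simp add: algebra_simps)
    also have "\<dots> \<le> m (q s) * (s * norm d) + (\<rho>f + \<rho>r) * D x (q s) + s * (g \<bullet> d) + \<rho>f * D (q s) x
        + \<rho>r * (\<omega> (q s) - \<omega> x)"
      using fq Fq by simp
    \<comment> \<open>Writing the kernel increment as a distance lets the \<open>\<rho>f\<close> and
      \<open>\<rho>r\<close> terms pair with \<open>D x (q s)\<close> into a symmetrised distance.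
      That is \<open>s\<close> times a gradient difference vanishing with \<open>s\<close>, so it
      disappears after division by \<open>s\<close>.\<close>
    also have "\<omega> (q s) - \<omega> x = D (q s) x - s * (G x \<bullet> d)"
      by (simp add: bregman_def q_def)
    also have "m (q s) * (s * norm d) + (\<rho>f + \<rho>r) * D x (q s) + s * (g \<bullet> d) + \<rho>f * D (q s) x
        + \<rho>r * (D (q s) x - s * (G x \<bullet> d)) =
        s * (m (q s) * norm d + g \<bullet> d - \<rho>r * (G x \<bullet> d)) + (\<rho>f + \<rho>r) * (D x (q s) + D (q s) x)"
      by (simp add: algebra_simps)
    also have "D x (q s) + D (q s) x = s * ((G x - G (q s)) \<bullet> d)"
      by (simp add: bregman_sym) (simp add: q_def)
    also have "s * (m (q s) * norm d + g \<bullet> d - \<rho>r * (G x \<bullet> d)) + (\<rho>f + \<rho>r) * (s * ((G x - G (q s)) \<bullet> d))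
      = s * (m (q s) * norm d + g \<bullet> d - \<rho>r * (G x \<bullet> d) + (\<rho>f + \<rho>r) * ((G x - G (q s)) \<bullet> d))"
      by (simp add: algebra_simps)
    finally show ?thesis using s by (simp only: mult_le_cancel_left_pos)
  qed
  have "continuous_on UNIV (\<lambda>s. m (q s) * norm d + g \<bullet> d - \<rho>r * (G x \<bullet> d) + (\<rho>f + \<rho>r) * ((G x - G (q s)) \<bullet> d))"
    unfolding q_def by (intro continuous_intros continuous_on_compose2[OF m]
      continuous_on_compose2[OF continuous_nabla]) auto
  then have "((\<lambda>s. m (q s) * norm d + g \<bullet> d - \<rho>r * (G x \<bullet> d) + (\<rho>f + \<rho>r) * ((G x - G (q s)) \<bullet> d))
      \<longlongrightarrow> m (q 0) * norm d + g \<bullet> d - \<rho>r * (G x \<bullet> d) + (\<rho>f + \<rho>r) * ((G x - G (q 0)) \<bullet> d)) (at_right 0)"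
    unfolding continuous_on_def by (meson UNIV_I filterlim_mono order_refl at_le subset_UNIV)
  from tendsto_lowerbound[OF this eventually_at_rightI[of 0 1, OF ev]]
  have "(r' x + \<rho>r * \<omega> x) - (r' y + \<rho>r * \<omega> y) \<le> m x * norm d + g \<bullet> d - \<rho>r * (G x \<bullet> d)"
    by (simp add: q_def)
  then show ?thesis
    by (simp add: bregman_def d_def norm_minus_commute inner_diff_right algebra_simps)
qed

end

section \<open>Composite problems and the proximal subgradient iteration\<close>

locale composite_problem = bregman_kernel +
  fixes f r :: "'a \<Rightarrow> ereal" and \<rho>f \<rho>r Fstar :: real
  assumes f_nm: "\<And>y. f y \<noteq> -\<infinity>" and r_nm: "\<And>y. r y \<noteq> -\<infinity>"
    and f_lsc: "lower_semicont f" and r_lsc: "lower_semicont r"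
    and \<rho>f: "0 < \<rho>f" and \<rho>r: "0 < \<rho>r"
    and f_rwc: "rel_weakly_convex \<rho>f \<omega> f" and r_rwc: "rel_weakly_convex \<rho>r \<omega> r"
    and Fstar_le: "\<And>y. ereal Fstar \<le> f y + r y"
    and F_finite: "\<exists>y. f y + r y < \<infinity>"
begin

abbreviation F :: "'a \<Rightarrow> ereal" where "F \<equiv> \<lambda>z. f z + r z"
abbreviation \<rho>F :: real where "\<rho>F \<equiv> \<rho>f + \<rho>r"

text \<open>\<open>real_of_ereal\<close> loses nothing for admissible \<open>lam\<close>: by
  \<open>prox_props\<close> the envelope is attained with a finite value.\<close>

definition gap :: "real \<Rightarrow> 'a \<Rightarrow> real" where
  "gap lam x = real_of_ereal (bregman_envelope \<omega> lam F x) - Fstar"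

section \<open>The envelope gap and its decrease in one step\<close>

lemma F_nm: "F y \<noteq> -\<infinity>"
  using f_nm[of y] r_nm[of y] by simp

lemma F_lsc: "lower_semicont F"
  by (intro lower_semicont_add f_lsc r_lsc f_nm r_nm)

lemma F_rwc: "rel_weakly_convex \<rho>F \<omega> F"
  by (intro rel_weakly_convex_add f_rwc r_rwc f_nm r_nm)

lemma prox_props:
  assumes lam: "0 < lam" "lam * \<rho>F < 1"
  obtains fh rh where "f (bregman_prox \<omega> lam F x) = ereal fh" "r (bregman_prox \<omega> lam F x) = ereal rh"
    "gap lam x = fh + rh + 1 / lam * D (bregman_prox \<omega> lam F x) x - Fstar"
    "\<And>y. ereal (fh + rh + 1 / lam * D (bregman_prox \<omega> lam F x) x) \<le> F y + ereal (1 / lam * D y x)"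
proof -
  define h where "h = bregman_prox \<omega> lam F x"
  obtain y0 b0 where y0: "F y0 = ereal b0"
  proof -
    obtain y where "F y < \<infinity>" using F_finite by blast
    then show ?thesis using that[of y] F_nm[of y] by (cases "F y") simp_all
  qed
  \<comment> \<open>The constant \<open>Fstar\<close> serves as minorant with slope 0; subtracting a
    nonnegative distance only lowers it.\<close>
  have minor: "ereal (Fstar + 0 \<bullet> (y - x) - \<rho>F * D y x) \<le> F y" for y
    using Fstar_le[of y] bregman_nonneg[of y x] \<rho>f \<rho>r by (intro order_trans[OF _ Fstar_le]) simp
  obtain p where p: "\<And>y. F p + ereal (1 / lam * D p x) \<le> F y + ereal (1 / lam * D y x)"
    using prox_exists[OF F_lsc F_nm y0 minor lam] by blast
  \<comment> \<open>\<open>arg_min\<close> is a choice operator, so a minimiser has to be exhibited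
    before the chosen point is known to be one.\<close>
  have "is_arg_min (\<lambda>y. F y + ereal (1 / lam * D y x)) (\<lambda>_. True) p"
    using p by (simp add: is_arg_min_linorder)
  then have "is_arg_min (\<lambda>y. F y + ereal (1 / lam * D y x)) (\<lambda>_. True) h"
    unfolding h_def bregman_prox_def arg_min_def by (rule someI)
  then have min: "F h + ereal (1 / lam * D h x) \<le> F y + ereal (1 / lam * D y x)" for y
    by (simp add: is_arg_min_linorder)
  obtain fh rh where fin: "f h = ereal fh" "r h = ereal rh"
    using min[of y0] y0 f_nm[of h] r_nm[of h] by (cases "f h"; cases "r h") auto
  have "bregman_envelope \<omega> lam F x = F h + ereal (1 / lam * D h x)"
    unfolding bregman_envelope_def by (intro antisym INF_lower INF_greatest min) simp
  then have "gap lam x = fh + rh + 1 / lam * D h x - Fstar" unfolding gap_def using fin by simp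
  then show ?thesis using that fin min unfolding h_def by simp
qed

lemma gap_nonneg:
  assumes "0 < lam" "lam * \<rho>F < 1"
  shows "0 \<le> gap lam x"
proof -
  obtain fh rh where "f (bregman_prox \<omega> lam F x) = ereal fh" "r (bregman_prox \<omega> lam F x) = ereal rh"
    "gap lam x = fh + rh + 1 / lam * D (bregman_prox \<omega> lam F x) x - Fstar"
    by (rule prox_props[OF assms, of x]) (rule that, assumption+)
  moreover have "0 \<le> 1 / lam * D (bregman_prox \<omega> lam F x) x"
    using bregman_nonneg assms by simp
  ultimately show ?thesis
    using Fstar_le[of "bregman_prox \<omega> lam F x"] by simp
qed

text \<open>The proximal point \<open>h\<close> of \<open>x\<close> competes in the envelope at
  \<open>y\<close>. For fixed \<open>x\<close> this bounds the gap by a continuous function of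
  \<open>y\<close> with equality at \<open>y = x\<close>.\<close>

lemma gap_le_shift:
  fixes x :: 'a
  assumes "0 < lam" "lam * \<rho>F < 1"
  defines "h \<equiv> bregman_prox \<omega> lam F x"
  shows "gap lam y \<le> gap lam x + 1 / lam * (D h y - D h x)"
proof -
  obtain fh rh where h: "f h = ereal fh" "r h = ereal rh" "gap lam x = fh + rh + 1 / lam * D h x - Fstar"
    by (rule prox_props[OF assms(1,2), of x, folded h_def]) (rule that, assumption+)
  obtain fy ry where y: "gap lam y = fy + ry + 1 / lam * D (bregman_prox \<omega> lam F y) y - Fstar"
    "\<And>u. ereal (fy + ry + 1 / lam * D (bregman_prox \<omega> lam F y) y) \<le> F u + ereal (1 / lam * D u y)"
    by (rule prox_props[OF assms(1,2), of y]) (rule that, assumption+)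
  have "fy + ry + 1 / lam * D (bregman_prox \<omega> lam F y) y \<le> fh + rh + 1 / lam * D h y"
    using y(2)[of h] h(1,2) by simp
  then show ?thesis using h(3) y(1) by (simp add: right_diff_distrib)
qed

text \<open>The subgradient \<open>(1 / lam) *\<^sub>R (G x - G h)\<close> of \<open>F\<close> at
  \<open>h\<close> is tested at \<open>x\<close>; its pairing with \<open>x - h\<close> is the
  symmetrised distance, which is how the stationarity measure enters.\<close>

lemma prox_gap:
  fixes x :: 'a
  assumes lam: "0 < lam" "lam * \<rho>F < 1"
  defines "h \<equiv> bregman_prox \<omega> lam F x"
  assumes fin: "f x = ereal fx" "r x = ereal rx" "f h = ereal fh" "r h = ereal rh"
  shows "fh + rh \<le> fx + rx - 1 / lam * (D h x + D x h) + \<rho>F * D x h"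
proof -
  obtain fh' rh' where h: "f h = ereal fh'" "r h = ereal rh'"
    "\<And>y. ereal (fh' + rh' + 1 / lam * D h x) \<le> F y + ereal (1 / lam * D y x)"
    by (rule prox_props[OF lam, of x, folded h_def]) (rule that, assumption+)
  have "(1 / lam) *\<^sub>R (G x - G h) \<in> rel_subdiff \<rho>F \<omega> F h"
    using prox_subgradient[OF F_rwc, of h "fh' + rh'" lam x] h F_nm by simp
  from this[unfolded rel_subdiff_iff, THEN conjunct2, rule_format, of x]
  have "fh + rh + (((1 / lam) *\<^sub>R (G x - G h)) \<bullet> (x - h) - \<rho>F * D x h) \<le> fx + rx"
    using fin by simp
  moreover have "((1 / lam) *\<^sub>R (G x - G h)) \<bullet> (x - h) = 1 / lam * (D h x + D x h)"
    unfolding inner_scaleR_left bregman_sym[of x h, symmetric] by simp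
  ultimately show ?thesis by linarith
qed

text \<open>Three inequalities scaled by \<open>t\<close> are added: optimality of \<open>x'\<close>
  tested at \<open>h\<close>, the inequality of \<open>g\<close> for \<open>f\<close> tested at
  \<open>h\<close>, and \<open>prox_gap\<close>. The values of \<open>f\<close> and \<open>r\<close>
  at \<open>h\<close> cancel.\<close>

lemma method_step:
  fixes x :: 'a
  assumes g: "g \<in> rel_subdiff \<rho>f \<omega> f x"
    and step: "is_arg_min (\<lambda>z. ereal (g \<bullet> (z - x)) + r z + ereal (1 / t * D z x)) (\<lambda>_. True) x'"
    and t: "0 < t"
    and lam: "0 < lam" "lam * \<rho>F < 1"
    and fin: "f x = ereal fx" "r x = ereal rx" "r x' = ereal rx'"
  defines "h \<equiv> bregman_prox \<omega> lam F x"
  shows "(1 - t * \<rho>r) * (D h x' - D h x) \<le>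
    - (t * (1 / lam - \<rho>F) * (D h x + D x h)) - D x' x + t * (rx - rx' + g \<bullet> (x - x'))"
proof -
  obtain fh rh where h: "f h = ereal fh" "r h = ereal rh"
    by (rule prox_props[OF lam, of x, folded h_def]) (rule that, assumption+)
  have gap: "fh + rh \<le> fx + rx - 1 / lam * (D h x + D x h) + \<rho>F * D x h"
    using prox_gap[OF lam fin(1,2)] h unfolding h_def by simp
  define \<psi> where "\<psi> = (\<lambda>z. g \<bullet> (z - x) + 1 / t * D z x)"
  have \<psi>: "GDERIV \<psi> x' :> g + (1 / t) *\<^sub>R (G x' - G x)"
  proof -
    have "((\<lambda>z. g \<bullet> (z - x)) has_derivative (\<lambda>v. v \<bullet> g)) (at x')"
      by (auto intro!: derivative_eq_intros simp: inner_commute)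
    moreover have "((\<lambda>z. 1 / t * D z x) has_derivative (\<lambda>v. v \<bullet> ((1 / t) *\<^sub>R (G x' - G x)))) (at x')"
      using has_derivative_mult_right[OF GDERIV_bregman_left[of x x', unfolded gderiv_def], of "1/t"] by simp
    ultimately show ?thesis unfolding \<psi>_def by (intro GDERIV_add) (simp_all add: gderiv_def)
  qed
  have min: "r x' + ereal (\<psi> x') \<le> r y + ereal (\<psi> y)" for y
  proof -
    have "ereal (g \<bullet> (x' - x)) + r x' + ereal (1 / t * D x' x) \<le> ereal (g \<bullet> (y - x)) + r y + ereal (1 / t * D y x)"
      using step by (simp add: is_arg_min_linorder)
    then show ?thesis unfolding \<psi>_def fin(3) by (cases "r y") simp_all
  qed
  have "- (g + (1 / t) *\<^sub>R (G x' - G x)) \<in> rel_subdiff \<rho>r \<omega> r x'"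
    by (rule argmin_imp_rel_subdiff[OF r_rwc fin(3) r_nm \<psi> min])
  then have "ereal rx' + ereal (- (g + (1 / t) *\<^sub>R (G x' - G x)) \<bullet> (h - x') - \<rho>r * D h x') \<le> r h"
    unfolding rel_subdiff_iff using fin by simp
  then have "rx' - g \<bullet> (h - x') - 1 / t * ((G x' - G x) \<bullet> (h - x')) - \<rho>r * D h x' \<le> rh"
    using h by (simp add: inner_add_left inner_diff_left)
  also have "(G x' - G x) \<bullet> (h - x') = D h x - D h x' - D x' x"
    using bregman_three_points[of h x x'] by simp
  finally have t_rh: "t * (rx' - g \<bullet> (h - x') - 1 / t * (D h x - D h x' - D x' x) - \<rho>r * D h x') \<le> t * rh"
    using t by (intro mult_left_mono) simp_all
  then have 1: "t * rx' - t * (g \<bullet> (h - x')) - (D h x - D h x' - D x' x) - t * \<rho>r * D h x' \<le> t * rh"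
  proof -
    have "t * (rx' - p - 1 / t * A - \<rho>r * C) = t * rx' - t * p - A - t * \<rho>r * C" for p A C
      using t by (simp add: field_simps)
    then show ?thesis using t_rh by (simp only:)
  qed
  have "fx + (g \<bullet> (h - x) - \<rho>f * D h x) \<le> fh"
    using g[unfolded rel_subdiff_iff, THEN conjunct2, rule_format, of h] fin h by simp
  then have 2: "t * (fx + (g \<bullet> (h - x) - \<rho>f * D h x)) \<le> t * fh" using t by (intro mult_left_mono) simp_all
  have 3: "t * (fh + rh) \<le> t * (fx + rx - 1 / lam * (D h x + D x h) + \<rho>F * D x h)"
    using gap t by (intro mult_left_mono) simp_all
  \<comment> \<open>With \<open>A\<close>, \<open>B\<close>, \<open>C\<close>, \<open>E\<close> for
    \<open>D h x\<close>, \<open>D x h\<close>, \<open>D h x'\<close>, \<open>D x' x\<close>: the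
    \<open>\<rho>f * A\<close> of the second inequality and the \<open>\<rho>r * A\<close> from
    factoring out \<open>1 - t * \<rho>r\<close> make \<open>\<rho>F * A\<close>, which joins
    \<open>\<rho>F * B\<close>.\<close>
  have arith: "(1 - t * \<rho>r) * (C - A) \<le> - (t * (l - \<rho>F) * (A + B)) - E + t * (rx - rx' + (p - q))"
    if "t * rx' - t * p - (A - C - E) - t * \<rho>r * C \<le> t * rh"
      "t * (fx + (q - \<rho>f * A)) \<le> t * fh"
      "t * (fh + rh) \<le> t * (fx + rx - l * (A + B) + \<rho>F * B)" for A B C E p q l :: real
    using that by (simp add: algebra_simps)
  have "g \<bullet> (x - x') = g \<bullet> (h - x') - g \<bullet> (h - x)" by (simp add: inner_diff_right)
  then show ?thesis using arith[OF 1 2 3] by (simp only:)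
qed

text \<open>Division by \<open>1 - t * \<rho>r\<close> and by \<open>lam\<close>, then
  \<open>gap_le_shift\<close>. The product of \<open>1 / lam\<close> and
  \<open>1 / lam - \<rho>F\<close> is \<open>(1 - lam * \<rho>F) / lam\<^sup>2\<close>, matching the
  scaling in \<open>D_sym\<close>. The slot \<open>e\<close> receives a different error bound in
  each regime.\<close>

lemma step_decrease:
  assumes g: "g \<in> rel_subdiff \<rho>f \<omega> f x"
    and step: "is_arg_min (\<lambda>z. ereal (g \<bullet> (z - x)) + r z + ereal (1 / t * D z x)) (\<lambda>_. True) x'"
    and t: "0 < t" "0 < 1 - t * \<rho>r"
    and lam: "0 < lam" "lam * \<rho>F < 1"
    and fin: "f x = ereal fx" "r x = ereal rx" "r x' = ereal rx'"
    and e: "t * (rx - rx' + g \<bullet> (x - x')) - D x' x \<le> e"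
  shows "gap lam x' \<le> gap lam x - (1 - lam * \<rho>F) * (t / (1 - t * \<rho>r)) * D_sym \<omega> lam (bregman_prox \<omega> lam F x) x
     + e / (lam * (1 - t * \<rho>r))"
proof -
  define h where "h = bregman_prox \<omega> lam F x"
  define S where "S = D h x + D x h"
  define k where "k = 1 - t * \<rho>r"
  have k: "0 < k" using t unfolding k_def by simp
  have "k * (D h x' - D h x) \<le> e - t * (1 / lam - \<rho>F) * S"
    using method_step[OF g step t(1) lam fin] e unfolding h_def S_def k_def by linarith
  then have "D h x' - D h x \<le> (e - t * (1 / lam - \<rho>F) * S) / k"
    using k by (simp add: pos_le_divide_eq mult.commute)
  then have "1 / lam * (D h x' - D h x) \<le> 1 / lam * ((e - t * (1 / lam - \<rho>F) * S) / k)"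
    using lam by (intro mult_left_mono) simp_all
  also have "\<dots> = e / (lam * k) - (1 - lam * \<rho>F) * (t / k) * (1 / lam\<^sup>2 * S)"
  proof -
    have "1 / lam * ((e - t * (1 / lam - \<rho>) * S) / k) =
        e / (lam * k) - (1 - lam * \<rho>) * (t / k) * (1 / lam\<^sup>2 * S)" for \<rho>
      using lam(1) k by (simp add: field_simps power2_eq_square)
    then show ?thesis .
  qed
  finally show ?thesis
    using gap_le_shift[OF lam, where x = x and y = x']
    unfolding h_def[symmetric] k_def[symmetric] D_sym_def S_def by linarith
qed

lemma step_decrease_bounded_subdiff:
  fixes x :: 'a
  assumes sub: "\<And>p v. v \<in> rel_subdiff \<rho>F \<omega> F p \<Longrightarrow> norm v \<le> sqrt (\<alpha> * gap lam p + \<beta>)"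
    and \<alpha>: "0 \<le> \<alpha>" and \<beta>: "0 \<le> \<beta>"
    and g: "g \<in> rel_subdiff \<rho>f \<omega> f x"
    and step: "is_arg_min (\<lambda>z. ereal (g \<bullet> (z - x)) + r z + ereal (1 / t * D z x)) (\<lambda>_. True) x'"
    and t: "0 < t" "t \<le> lam" and lam: "0 < lam" "lam * \<rho>F < 1"
  shows "gap lam x' \<le> gap lam x - (1 - lam * \<rho>F) * t * D_sym \<omega> lam (bregman_prox \<omega> lam F x) x
    + (\<alpha> * gap lam x + \<beta>) / (2 * lam * (1 - lam * \<rho>r)\<^sup>2) * t\<^sup>2"
proof -
  define h where "h = bregman_prox \<omega> lam F x"
  define m where "m = (\<lambda>p. sqrt (\<alpha> * (gap lam x + 1 / lam * (D h p - D h x)) + \<beta>))"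
  \<comment> \<open>a continuous majorant of the subgradient bound which agrees with it at \<open>x\<close>\<close>
  have m: "continuous_on UNIV m"
    unfolding m_def by (intro continuous_intros continuous_bregman)
  have sub_m: "norm v \<le> m p" if "v \<in> rel_subdiff \<rho>F \<omega> F p" for p v
  proof -
    have "\<alpha> * gap lam p \<le> \<alpha> * (gap lam x + 1 / lam * (D h p - D h x))"
      using gap_le_shift[OF lam, of p x] \<alpha> unfolding h_def by (intro mult_left_mono)
    then have "sqrt (\<alpha> * gap lam p + \<beta>) \<le> m p" unfolding m_def by simp
    with sub[OF that] show ?thesis by (rule order_trans)
  qed
  have minor: "ereal (Fstar + 0 \<bullet> (y - z) - \<rho>F * D y z) \<le> F y" for y z
    using bregman_nonneg[of y z] \<rho>f \<rho>r by (intro order_trans[OF _ Fstar_le]) simp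
  have incr: "F z \<le> F y + ereal (m z * norm (y - z) + \<rho>F * D y z)" for y z
    using bounded_subdiff_imp_increment_bound[OF F_rwc F_lsc F_nm _ minor m sub_m] \<rho>f \<rho>r by simp
  obtain y0 where y0: "F y0 < \<infinity>" using F_finite by blast
  have Fz: "F z < \<infinity>" for z
    using incr[of z y0] y0 F_nm[of y0] by (cases "F y0") auto
  define f' where "f' = (\<lambda>z. real_of_ereal (f z))"
  define r' where "r' = (\<lambda>z. real_of_ereal (r z))"
  have f': "f z = ereal (f' z)" for z
    unfolding f'_def using Fz[of z] f_nm[of z] r_nm[of z] by (cases "f z"; cases "r z") auto
  have r': "r z = ereal (r' z)" for z
    unfolding r'_def using Fz[of z] f_nm[of z] r_nm[of z] by (cases "f z"; cases "r z") auto
  have incr': "f' z + r' z \<le> f' y + r' y + m z * norm (y - z) + \<rho>F * D y z" for y z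
    using incr[of z y] by (simp add: f' r')
  define n where "n = norm (x' - x)"
  define k where "k = 1 - t * \<rho>r"
  define k0 where "k0 = 1 - lam * \<rho>r"
  have k0: "0 < k0" unfolding k0_def using lam \<rho>f \<rho>r by (simp add: algebra_simps) (smt (verit) mult_pos_pos)
  have k: "k0 \<le> k" "k \<le> 1"
    unfolding k0_def k_def using t \<rho>r by (simp_all add: mult_right_mono)
  have k_pos: "0 < k" using k k0 by simp
  have "r' x - r' x' + g \<bullet> (x - x') \<le> m x * n + \<rho>r * D x' x"
    unfolding n_def norm_minus_commute[of x']
    by (rule summand_increment_bound[OF r_rwc \<rho>f \<rho>r f' r' g m incr'])
  then have "t * (r' x - r' x' + g \<bullet> (x - x')) \<le> t * (m x * n + \<rho>r * D x' x)"
    using t by (intro mult_left_mono) simp_all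
  then have 1: "t * (r' x - r' x' + g \<bullet> (x - x')) - D x' x \<le> t * m x * n - k * D x' x"
    unfolding k_def by (simp add: left_diff_distrib distrib_left mult.assoc)
  have "k * (1/2 * n\<^sup>2) \<le> k * D x' x"
    unfolding n_def using k_pos bregman_ge_norm by (intro mult_left_mono) simp_all
  \<comment> \<open>Young's inequality from the square of \<open>k * n - t * m x\<close>.\<close>
  moreover have "t * m x * n - k * (1/2 * n\<^sup>2) \<le> (t * m x)\<^sup>2 / (2 * k)"
  proof -
    have "0 \<le> (k * n - t * m x)\<^sup>2" by simp
    then have "2 * k * (t * m x * n - k * (1/2 * n\<^sup>2)) \<le> (t * m x)\<^sup>2"
      by (simp add: power2_eq_square algebra_simps)
    then show ?thesis using k_pos by (simp add: pos_le_divide_eq mult.commute)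
  qed
  ultimately have e: "t * (r' x - r' x' + g \<bullet> (x - x')) - D x' x \<le> (t * m x)\<^sup>2 / (2 * k)"
    using 1 by simp
  define S where "S = D_sym \<omega> lam h x"
  have S: "0 \<le> S" unfolding S_def D_sym_def using bregman_nonneg by simp
  have main: "gap lam x' \<le> gap lam x - (1 - lam * \<rho>F) * (t / k) * S + (t * m x)\<^sup>2 / (2 * k) / (lam * k)"
    using step_decrease[OF g step t(1) _ lam f' r' r' e] k_pos unfolding k_def S_def h_def by simp
  have "(1 - lam * \<rho>F) * t * S \<le> (1 - lam * \<rho>F) * (t / k) * S"
  proof -
    have "t * k \<le> t * 1" using k t by (intro mult_left_mono) simp_all
    then have "t \<le> t / k" using k_pos by (simp add: pos_le_divide_eq)
    then show ?thesis using S lam by (intro mult_right_mono mult_left_mono) simp_all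
  qed
  moreover have "(t * m x)\<^sup>2 / (2 * k) / (lam * k) \<le> (m x)\<^sup>2 / (2 * lam * k0\<^sup>2) * t\<^sup>2"
  proof -
    have "k0\<^sup>2 \<le> k\<^sup>2" using k k0 by (intro power_mono) simp_all
    then have "(t * m x)\<^sup>2 / (2 * lam * k\<^sup>2) \<le> (t * m x)\<^sup>2 / (2 * lam * k0\<^sup>2)"
      using lam k0 k_pos by (intro divide_left_mono mult_left_mono mult_pos_pos) simp_all
    then show ?thesis by (simp add: power2_eq_square mult_ac)
  qed
  moreover have "(m x)\<^sup>2 = \<alpha> * gap lam x + \<beta>"
    unfolding m_def using \<alpha> \<beta> gap_nonneg[OF lam, of x] by simp
  ultimately show ?thesis using main unfolding S_def h_def k0_def by simp
qed

text \<open>Exchanging the increment of \<open>r\<close> for that of \<open>F\<close> costs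
  \<open>f x' - f x\<close>, at most \<open>L * n\<close>; the inner product with \<open>g\<close>
  costs another \<open>L * n\<close>. Young's inequality against \<open>D x' x\<close> then gives
  the error \<open>2 * t\<^sup>2 * L\<^sup>2\<close>.\<close>

lemma step_decrease_Lipschitz:
  fixes x :: 'a
  assumes sub: "\<And>p v. v \<in> rel_subdiff \<rho>f \<omega> f p \<Longrightarrow> norm v \<le> L"
    and g: "g \<in> rel_subdiff \<rho>f \<omega> f x"
    and step: "is_arg_min (\<lambda>z. ereal (g \<bullet> (z - x)) + r z + ereal (1 / t * D z x)) (\<lambda>_. True) x'"
    and fin: "r x = ereal rx" "r x' = ereal rx'"
    and t: "0 < t" "0 < 1 - t * \<rho>r" and lam: "0 < lam" "lam * \<rho>F < 1"
  shows "gap lam x' \<le> gap lam x - (1 - lam * \<rho>F) * (t / (1 - t * \<rho>r)) * D_sym \<omega> lam (bregman_prox \<omega> lam F x) x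
    + (t / (lam * (1 - t * \<rho>r)) * (real_of_ereal (F x) - real_of_ereal (F x'))
        + 2 * L\<^sup>2 / lam * (t\<^sup>2 / (1 - t * \<rho>r)))"
proof -
  obtain fx where fx: "f x = ereal fx" using g unfolding rel_subdiff_iff by (cases "f x") auto
  \<comment> \<open>The subgradient inequality at \<open>x\<close> is recentred at an arbitrary
    \<open>z\<close> by the three-point identity, which tilts the slope by
    \<open>\<rho>f *\<^sub>R (G z - G x)\<close>.\<close>
  have minor: "ereal (fx + g \<bullet> (z - x) - \<rho>f * D z x + (g - \<rho>f *\<^sub>R (G z - G x)) \<bullet> (y - z) - \<rho>f * D y z) \<le> f y" for y z
  proof -
    have eq: "fx + g \<bullet> (z - x) - \<rho>f * D z x + (g - \<rho>f *\<^sub>R (G z - G x)) \<bullet> (y - z) - \<rho>f * D y z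
        = fx + (g \<bullet> (y - x) - \<rho>f * D y x)"
      unfolding bregman_three_points[of y x z] by (simp add: inner_diff_left inner_diff_right algebra_simps)
    show ?thesis
      using g[unfolded rel_subdiff_iff, THEN conjunct2, rule_format, of y] fx unfolding eq by simp
  qed
  have incr: "f z \<le> f y + ereal (L * norm (y - z) + \<rho>f * D y z)" for y z
    by (rule bounded_subdiff_imp_increment_bound[OF f_rwc f_lsc f_nm \<rho>f minor _ sub]) auto
  define f' where "f' = (\<lambda>z. real_of_ereal (f z))"
  have f': "f z = ereal (f' z)" for z
    unfolding f'_def using incr[of z x] fx f_nm[of z] by (cases "f z") auto
  have Lip: "f' z \<le> f' y + L * norm (y - z)" for y z
  proof (rule bounded_subdiff_imp_Lipschitz)
    show "f' z \<le> f' y + L * norm (y - z) + \<rho>f * D y z" for y z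
      using incr[of z y] by (simp add: f')
  qed (use \<rho>f in simp)
  define n where "n = norm (x' - x)"
  define d where "d = real_of_ereal (F x) - real_of_ereal (F x')"
  have d: "rx - rx' = d + f' x' - f' x" unfolding d_def by (simp add: f' fin)
  have "g \<bullet> (x - x') \<le> norm g * norm (x - x')" by (rule norm_cauchy_schwarz)
  also have "\<dots> \<le> L * n" unfolding n_def norm_minus_commute[of x] using sub[OF g] by (intro mult_right_mono) simp_all
  finally have "rx - rx' + g \<bullet> (x - x') \<le> d + 2 * L * n"
    using Lip[of x' x] d unfolding n_def by (simp add: norm_minus_commute)
  then have "t * (rx - rx' + g \<bullet> (x - x')) \<le> t * (d + 2 * L * n)"
    using t by (intro mult_left_mono) simp_all
  moreover have "1/2 * n\<^sup>2 \<le> D x' x" unfolding n_def by (rule bregman_ge_norm)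
  moreover have "2 * t * L * n - 1/2 * n\<^sup>2 \<le> 2 * t\<^sup>2 * L\<^sup>2"
  proof -
    have "0 \<le> (n - 2 * t * L)\<^sup>2" by simp
    then show ?thesis by (simp add: power2_eq_square algebra_simps)
  qed
  ultimately have e: "t * (rx - rx' + g \<bullet> (x - x')) - D x' x \<le> t * d + 2 * t\<^sup>2 * L\<^sup>2"
    by (simp add: distrib_left mult_ac)
  have "(t * d + 2 * t\<^sup>2 * L\<^sup>2) / (lam * (1 - t * \<rho>r)) =
      t / (lam * (1 - t * \<rho>r)) * d + 2 * L\<^sup>2 / lam * (t\<^sup>2 / (1 - t * \<rho>r))"
    by (simp add: add_divide_distrib mult_ac)
  then show ?thesis
    using step_decrease[OF g step t lam fx fin e] unfolding d_def by simp
qed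

section \<open>Rates for general step sizes\<close>

lemma method_facts:
  assumes "bregman_prox_subgradient \<omega> \<rho>f f r t g x"
  shows "0 < t k" "g k \<in> rel_subdiff \<rho>f \<omega> f (x k)"
    "is_arg_min (\<lambda>z. ereal (g k \<bullet> (z - x k)) + r z + ereal (1 / t k * D z (x k))) (\<lambda>_. True) (x (Suc k))"
  using assms unfolding bregman_prox_subgradient_def by blast+

text \<open>Common source of (a) and (b): \<open>B\<close> dominates the squared subgradient bound
  along the first \<open>K\<close> iterates, namely \<open>LF\<^sup>2\<close> in (a) and
  \<open>\<alpha> * CF + \<beta>\<close> in (b).\<close>

lemma rate_bounded_subdiff:
  assumes iterates: "bregman_prox_subgradient \<omega> \<rho>f f r t g x" and K: "0 < K"
    and sub: "\<And>p v. v \<in> rel_subdiff \<rho>F \<omega> F p \<Longrightarrow> norm v \<le> sqrt (\<alpha> * gap lam p + \<beta>)"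
    and \<alpha>: "0 \<le> \<alpha>" and \<beta>: "0 \<le> \<beta>"
    and t: "\<And>k. t k \<le> lam" and lam: "0 < lam" "lam * \<rho>F < 1"
    and B: "\<And>k. k < K \<Longrightarrow> \<alpha> * gap lam (x k) + \<beta> \<le> B"
  shows "(MIN k\<in>{0..K-1}. D_sym \<omega> lam (bregman_prox \<omega> lam F (x k)) (x k))
    \<le> (gap lam (x 0) + B / (2 * lam * (1 - lam * \<rho>r)\<^sup>2) * (\<Sum>k=0..K-1. (t k)\<^sup>2))
      / ((1 - lam * \<rho>F) * (\<Sum>k=0..K-1. t k))"
  unfolding sum_distrib_left[of "B / _"]
proof (rule Min_le_of_decrease[where E = "\<lambda>k. gap lam (x k)"])
  fix k assume k: "k < K"
  have "(\<alpha> * gap lam (x k) + \<beta>) / (2 * lam * (1 - lam * \<rho>r)\<^sup>2) * (t k)\<^sup>2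
      \<le> B / (2 * lam * (1 - lam * \<rho>r)\<^sup>2) * (t k)\<^sup>2"
    using B[OF k] lam by (intro mult_right_mono divide_right_mono) simp_all
  then show "gap lam (x (Suc k)) \<le> gap lam (x k)
      - (1 - lam * \<rho>F) * t k * D_sym \<omega> lam (bregman_prox \<omega> lam F (x k)) (x k)
      + B / (2 * lam * (1 - lam * \<rho>r)\<^sup>2) * (t k)\<^sup>2"
    using step_decrease_bounded_subdiff[OF sub \<alpha> \<beta> method_facts(2,3,1)[OF iterates] t lam, of k] by simp
qed (use K lam method_facts(1)[OF iterates] gap_nonneg[OF lam] in auto)

text \<open>Dropping the nonnegative stationarity term from the descent inequality leaves a
  recursion for the discrete Gronwall inequality, with increments proportional to the squared step
  sizes.\<close>

lemma gap_growth_bound: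
  assumes iterates: "bregman_prox_subgradient \<omega> \<rho>f f r t g x"
    and sub: "\<And>p v. v \<in> rel_subdiff \<rho>F \<omega> F p \<Longrightarrow> norm v \<le> sqrt (\<alpha> * gap lam p + \<beta>)"
    and \<alpha>: "0 \<le> \<alpha>" and \<beta>: "0 \<le> \<beta>"
    and t: "\<And>k. t k \<le> lam" and lam: "0 < lam" "lam * \<rho>F < 1"
    and C: "(\<Sum>k=0..K-1. (t k)\<^sup>2) \<le> C" and k: "k < K"
  shows "gap lam (x k) \<le> (gap lam (x 0) + C * \<beta> / (2 * (1 - lam * \<rho>r)\<^sup>2 * lam))
      * exp (C * \<alpha> / (2 * (1 - lam * \<rho>r)\<^sup>2 * lam))"
proof -
  define c where "c = 1 / (2 * (1 - lam * \<rho>r)\<^sup>2 * lam)"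
  have c: "0 \<le> c" unfolding c_def using lam by simp
  have step: "gap lam (x (Suc i)) \<le> gap lam (x i) + (\<alpha> * gap lam (x i) + \<beta>) * (c * (t i)\<^sup>2)" for i
  proof -
    have "0 \<le> (1 - lam * \<rho>F) * t i * D_sym \<omega> lam (bregman_prox \<omega> lam F (x i)) (x i)"
      unfolding D_sym_def using lam method_facts(1)[OF iterates, of i] bregman_nonneg
      by (intro mult_nonneg_nonneg add_nonneg_nonneg) simp_all
    moreover have "(\<alpha> * gap lam (x i) + \<beta>) / (2 * lam * (1 - lam * \<rho>r)\<^sup>2) * (t i)\<^sup>2
        = (\<alpha> * gap lam (x i) + \<beta>) * (c * (t i)\<^sup>2)"
      unfolding c_def by (simp add: mult_ac)
    ultimately show ?thesis
      using step_decrease_bounded_subdiff[OF sub \<alpha> \<beta> method_facts(2,3,1)[OF iterates] t lam, of i] by linarith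
  qed
  define Q where "Q = (\<Sum>i<k. c * (t i)\<^sup>2)"
  have "(\<Sum>i<k. (t i)\<^sup>2) \<le> C"
    using k by (intro order_trans[OF sum_mono2 C]) auto
  then have Q: "Q \<le> c * C" unfolding Q_def sum_distrib_left[symmetric] using c by (rule mult_left_mono)
  have "gap lam (x k) \<le> (gap lam (x 0) + \<beta> * Q) * exp (\<alpha> * Q)"
    unfolding Q_def using discrete_Gronwall[of k "\<lambda>i. gap lam (x i)" \<alpha> \<beta> "\<lambda>i. c * (t i)\<^sup>2"]
      step c \<alpha> \<beta> gap_nonneg[OF lam] by simp
  also have "\<dots> \<le> (gap lam (x 0) + \<beta> * (c * C)) * exp (\<alpha> * (c * C))"
  proof (rule mult_mono)
    show "gap lam (x 0) + \<beta> * Q \<le> gap lam (x 0) + \<beta> * (c * C)"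
      using Q \<beta> by (simp add: mult_left_mono)
    show "exp (\<alpha> * Q) \<le> exp (\<alpha> * (c * C))" using Q \<alpha> by (simp add: mult_left_mono)
    have "0 \<le> Q" unfolding Q_def using c by (intro sum_nonneg) simp
    then have "0 \<le> c * C" using Q by simp
    then show "0 \<le> gap lam (x 0) + \<beta> * (c * C)"
      using \<beta> gap_nonneg[OF lam] by simp
  qed simp
  finally show ?thesis unfolding c_def by (simp add: mult_ac)
qed

text \<open>The weights \<open>w\<close> inherit monotonicity from \<open>t\<close>, since
  numerators fall while denominators rise. Abel summation reduces the weighted differences of
  \<open>F\<close> to \<open>w 0 * (a 0 - Fstar)\<close> minus a nonnegative term.\<close>

lemma rate_Lipschitz:
  assumes iterates: "bregman_prox_subgradient \<omega> \<rho>f f r t g x" and K: "0 < K"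
    and sub: "\<And>p v. v \<in> rel_subdiff \<rho>f \<omega> f p \<Longrightarrow> norm v \<le> L"
    and x0: "r (x 0) < \<infinity>"
    and t: "antimono t" "\<And>k. 0 < 1 - t k * \<rho>r" and lam: "0 < lam" "lam * \<rho>F < 1"
  shows "(MIN k\<in>{0..K-1}. D_sym \<omega> lam (bregman_prox \<omega> lam F (x k)) (x k))
    \<le> (gap lam (x 0) + t 0 / (lam * (1 - t 0 * \<rho>r)) * (real_of_ereal (F (x 0)) - Fstar)
        + 2 * L\<^sup>2 / lam * (\<Sum>k=0..K-1. (t k)\<^sup>2 / (1 - t k * \<rho>r)))
      / ((1 - lam * \<rho>F) * (\<Sum>k=0..K-1. t k / (1 - t k * \<rho>r)))"
proof -
  define a where "a = (\<lambda>k. real_of_ereal (F (x k)))"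
  define w where "w = (\<lambda>k. t k / (lam * (1 - t k * \<rho>r)))"
  define e where "e = (\<lambda>k. 2 * L\<^sup>2 / lam * ((t k)\<^sup>2 / (1 - t k * \<rho>r)))"
  note m = method_facts[OF iterates]
  obtain y0 where y0: "r y0 < \<infinity>"
  proof -
    obtain y where "F y < \<infinity>" using F_finite by blast
    then show ?thesis using that[of y] f_nm[of y] by (cases "f y"; cases "r y") auto
  qed
  \<comment> \<open>The start lies in the domain by hypothesis; a later iterate does because its
    subproblem has a finite value at \<open>y0\<close>.\<close>
  have r_fin: "r (x k) = ereal (real_of_ereal (r (x k)))" for k
  proof (cases k)
    case 0
    then show ?thesis using x0 r_nm[of "x 0"] by (cases "r (x 0)") auto
  next
    case (Suc j)
    have "ereal (g j \<bullet> (x k - x j)) + r (x k) + ereal (1 / t j * D (x k) (x j))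
        \<le> ereal (g j \<bullet> (y0 - x j)) + r y0 + ereal (1 / t j * D y0 (x j))"
      using m(3)[of j] unfolding Suc by (simp add: is_arg_min_linorder)
    then show ?thesis using y0 r_nm[of "x k"] r_nm[of y0] by (cases "r (x k)"; cases "r y0") auto
  qed
  have f_fin: "f (x k) = ereal (real_of_ereal (f (x k)))" for k
    using m(2)[of k] unfolding rel_subdiff_iff by (cases "f (x k)") auto
  have a: "Fstar \<le> a k" for k
  proof -
    have "F (x k) = ereal (real_of_ereal (f (x k)) + real_of_ereal (r (x k)))"
      using f_fin[of k] r_fin[of k] by (metis plus_ereal.simps(1))
    then show ?thesis using Fstar_le[of "x k"] unfolding a_def by simp
  qed
  have w: "antimono w"
  proof (rule antimonoI)
    fix i j :: nat assume "i \<le> j"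
    then have tij: "t j \<le> t i" using t(1) by (rule antimonoD[rotated])
    then have "t j * \<rho>r \<le> t i * \<rho>r" using \<rho>r by (intro mult_right_mono) simp_all
    then show "w j \<le> w i" unfolding w_def
      using tij t(2)[of i] t(2)[of j] lam m(1)[of i] by (intro frac_le mult_left_mono mult_pos_pos) simp_all
  qed
  have w_pos: "0 < w k" for k unfolding w_def using m(1) t(2) lam by simp
  have "(MIN k\<in>{0..K-1}. D_sym \<omega> lam (bregman_prox \<omega> lam F (x k)) (x k))
    \<le> (gap lam (x 0) + (\<Sum>k=0..K-1. w k * (a k - a (Suc k)) + e k))
      / ((1 - lam * \<rho>F) * (\<Sum>k=0..K-1. t k / (1 - t k * \<rho>r)))"
  proof (rule Min_le_of_decrease[where E = "\<lambda>k. gap lam (x k)"])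
    fix k
    show "gap lam (x (Suc k)) \<le> gap lam (x k)
      - (1 - lam * \<rho>F) * (t k / (1 - t k * \<rho>r)) * D_sym \<omega> lam (bregman_prox \<omega> lam F (x k)) (x k)
      + (w k * (a k - a (Suc k)) + e k)"
      unfolding w_def a_def e_def
      by (rule step_decrease_Lipschitz[OF sub m(2,3) r_fin r_fin m(1) t(2) lam])
  qed (use K lam m(1) t(2) gap_nonneg[OF lam] in auto)
  also have "\<dots> \<le> (gap lam (x 0) + w 0 * (a 0 - Fstar) + (\<Sum>k=0..K-1. e k))
      / ((1 - lam * \<rho>F) * (\<Sum>k=0..K-1. t k / (1 - t k * \<rho>r)))"
  proof (rule divide_right_mono)
    have "{0..K-1} = {..<K}" using K by auto
    then have "(\<Sum>k=0..K-1. w k * (a k - a (Suc k))) \<le> w 0 * (a 0 - Fstar) - w K * (a K - Fstar)"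
      using antimono_weighted_telescope_le[OF w a] by simp
    also have "\<dots> \<le> w 0 * (a 0 - Fstar)" using w_pos[of K] a[of K] by simp
    finally show "gap lam (x 0) + (\<Sum>k=0..K-1. w k * (a k - a (Suc k)) + e k)
        \<le> gap lam (x 0) + w 0 * (a 0 - Fstar) + (\<Sum>k=0..K-1. e k)"
      by (simp add: sum.distrib)
    show "0 \<le> (1 - lam * \<rho>F) * (\<Sum>k=0..K-1. t k / (1 - t k * \<rho>r))"
      using lam m(1) t(2) by (intro mult_nonneg_nonneg sum_nonneg divide_nonneg_nonneg) (simp_all add: less_imp_le)
  qed
  finally show ?thesis unfolding w_def a_def e_def sum_distrib_left .
qed

section \<open>The parameter \<open>1 / (2 * \<rho>F)\<close> with constant step sizes\<close>

lemma half_parameter: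
  "0 < 1 / (2 * \<rho>F)" "1 / (2 * \<rho>F) * \<rho>F < 1" "1 / (2 * \<rho>F) < 1 / \<rho>F"
  "1/2 \<le> 1 - \<rho>r / (2 * \<rho>F)" "1 - 1 / (2 * \<rho>F) * \<rho>r = 1 - \<rho>r / (2 * \<rho>F)"
  using \<rho>f \<rho>r by (simp_all add: field_simps)

lemma parameter_bound: "lam < 1 / \<rho>F \<Longrightarrow> lam * \<rho>F < 1"
  using \<rho>f \<rho>r by (simp add: pos_less_divide_eq)

lemma rate_bounded_subdiff_constant_step:
  assumes iterates: "bregman_prox_subgradient \<omega> \<rho>f f r t g x" and K: "0 < K"
    and sub: "\<And>p v. v \<in> rel_subdiff \<rho>F \<omega> F p \<Longrightarrow> norm v \<le> sqrt (\<alpha> * gap (1 / (2 * \<rho>F)) p + \<beta>)"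
    and \<alpha>: "0 \<le> \<alpha>" and \<beta>: "0 \<le> \<beta>"
    and B: "0 < B" "\<And>k. k < K \<Longrightarrow> \<alpha> * gap (1 / (2 * \<rho>F)) (x k) + \<beta> \<le> B"
    and \<delta>: "0 < \<delta>" "gap (1 / (2 * \<rho>F)) (x 0) \<le> \<delta>"
    and t: "\<And>k. t k = T" "T \<le> 1 / (2 * \<rho>F)"
      "T \<le> (1 - \<rho>r / (2 * \<rho>F)) * sqrt (\<delta> / (\<rho>F * B * real K))"
  shows "(MIN k\<in>{0..K-1}. D_sym \<omega> (1 / (2 * \<rho>F)) (bregman_prox \<omega> (1 / (2 * \<rho>F)) F (x k)) (x k))
    \<le> 4 * (\<delta> / (real K * T))"
proof (rule constant_step_rate[OF \<delta>(1) _ B(1) half_parameter(4) _ K refl \<delta>(2) t(3)])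
  show "0 < \<rho>F" using \<rho>f \<rho>r by simp
  show "0 < T" using method_facts(1)[OF iterates, of 0] t(1) by simp
  show "(MIN k\<in>{0..K-1}. D_sym \<omega> (1 / (2 * \<rho>F)) (bregman_prox \<omega> (1 / (2 * \<rho>F)) F (x k)) (x k))
    \<le> (gap (1 / (2 * \<rho>F)) (x 0) + B / (2 * (1 / (2 * \<rho>F)) * (1 - \<rho>r / (2 * \<rho>F))\<^sup>2) * (\<Sum>k=0..K-1. T\<^sup>2))
      / ((1 - 1 / (2 * \<rho>F) * \<rho>F) * (\<Sum>k=0..K-1. T))"
    using rate_bounded_subdiff[OF iterates K sub \<alpha> \<beta> _ half_parameter(1,2) B(2)] t(1,2)
    unfolding half_parameter(5) by simp
qed

text \<open>A uniform bound is the growth condition with \<open>\<alpha> = 0\<close>, which lets (a)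
  share the machinery of (b).\<close>

lemma bounded_subdiff_growth:
  assumes "\<forall>z. \<forall>v\<in>rel_subdiff \<rho>F \<omega> F z. norm v \<le> LF" "0 < LF"
  shows "v \<in> rel_subdiff \<rho>F \<omega> F z \<Longrightarrow> norm v \<le> sqrt (0 * gap lam z + LF\<^sup>2)"
  using assms by simp

lemma rate_uniformly_bounded_subdiff:
  assumes iterates: "bregman_prox_subgradient \<omega> \<rho>f f r t g x" and K: "0 < K"
    and LF: "0 < LF" and sub: "\<forall>z. \<forall>v\<in>rel_subdiff \<rho>F \<omega> F z. norm v \<le> LF"
    and lam: "0 < lam" "lam < 1 / \<rho>F" and t: "\<And>k. t k \<le> lam"
  shows "(MIN k\<in>{0..K-1}. D_sym \<omega> lam (bregman_prox \<omega> lam F (x k)) (x k))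
    \<le> (gap lam (x 0) + LF\<^sup>2 / (2 * lam * (1 - lam * \<rho>r)\<^sup>2) * (\<Sum>k=0..K-1. (t k)\<^sup>2))
      / ((1 - lam * \<rho>F) * (\<Sum>k=0..K-1. t k))"
  by (rule rate_bounded_subdiff[OF iterates K bounded_subdiff_growth[OF sub LF] _ _ t lam(1) parameter_bound[OF lam(2)]])
    simp_all

lemma rate_uniformly_bounded_subdiff_constant_step:
  assumes iterates: "bregman_prox_subgradient \<omega> \<rho>f f r t g x" and K: "0 < K"
    and LF: "0 < LF" and sub: "\<forall>z. \<forall>v\<in>rel_subdiff \<rho>F \<omega> F z. norm v \<le> LF"
    and \<delta>: "0 < \<delta>" "gap (1 / (2 * \<rho>F)) (x 0) \<le> \<delta>"
    and t: "\<And>k. t k = min (1 / (2 * \<rho>F)) ((1 - \<rho>r / (2 * \<rho>F)) / LF * sqrt (\<delta> / (\<rho>F * real K)))"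
  shows "(MIN k\<in>{0..K-1}. D_sym \<omega> (1 / (2 * \<rho>F)) (bregman_prox \<omega> (1 / (2 * \<rho>F)) F (x k)) (x k))
    \<le> 8 * max (\<rho>F * \<delta> / real K) (LF * sqrt (\<rho>F * \<delta> / real K))" (is "?M \<le> _")
proof -
  define T where "T = min (1 / (2 * \<rho>F)) ((1 - \<rho>r / (2 * \<rho>F)) / LF * sqrt (\<delta> / (\<rho>F * real K)))"
  have \<rho>F: "0 < \<rho>F" using \<rho>f \<rho>r by simp
  have b: "(1 - \<rho>r / (2 * \<rho>F)) / LF * sqrt (\<delta> / (\<rho>F * real K))
      = (1 - \<rho>r / (2 * \<rho>F)) * sqrt (\<delta> / (\<rho>F * LF\<^sup>2 * real K))"
    using LF by (simp add: real_sqrt_divide real_sqrt_mult)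
  have M: "?M \<le> 4 * (\<delta> / (real K * T))"
  proof (rule rate_bounded_subdiff_constant_step[OF iterates K bounded_subdiff_growth[OF sub LF] _ _ _ _ \<delta>, where B = "LF\<^sup>2"])
    show "t k = T" for k unfolding T_def by (rule t)
    show "T \<le> 1 / (2 * \<rho>F)" unfolding T_def by (rule min.cobounded1)
    show "T \<le> (1 - \<rho>r / (2 * \<rho>F)) * sqrt (\<delta> / (\<rho>F * LF\<^sup>2 * real K))"
      unfolding T_def b by (rule min.cobounded2)
  qed (use LF in simp_all)
  consider "T = 1 / (2 * \<rho>F)" | "T = (1 - \<rho>r / (2 * \<rho>F)) * sqrt (\<delta> / (\<rho>F * LF\<^sup>2 * real K))"
    unfolding T_def b by linarith
  then show ?thesis
  proof cases
    case 1
    have "4 * (\<delta> / (real K * T)) = 8 * (\<rho>F * \<delta> / real K)" unfolding 1 by simp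
    then show ?thesis using M by simp
  next
    case 2
    have "4 * (\<delta> / (real K * T)) \<le> 8 * sqrt (LF\<^sup>2 * \<rho>F * \<delta> / real K)"
      unfolding 2 using \<delta> \<rho>F LF K half_parameter(4) by (intro step_scale_bound) simp_all
    also have "sqrt (LF\<^sup>2 * \<rho>F * \<delta> / real K) = LF * sqrt (\<rho>F * \<delta> / real K)"
      using LF by (simp add: real_sqrt_mult real_sqrt_divide)
    finally show ?thesis using M by simp
  qed
qed

lemma rate_gap_bounded_subdiff:
  assumes iterates: "bregman_prox_subgradient \<omega> \<rho>f f r t g x" and K: "0 < K"
    and \<alpha>: "0 < \<alpha>" and \<beta>: "0 < \<beta>"
    and sub: "\<forall>z. \<forall>v\<in>rel_subdiff \<rho>F \<omega> F z. norm v \<le> sqrt (\<alpha> * gap lam z + \<beta>)"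
    and lam: "0 < lam" "lam < 1 / \<rho>F" and t: "\<And>k. t k \<le> lam"
    and C: "(\<Sum>k=0..K-1. (t k)\<^sup>2) \<le> C"
    and CF: "CF = (gap lam (x 0) + C * \<beta> / (2 * (1 - lam * \<rho>r)\<^sup>2 * lam))
      * exp (C * \<alpha> / (2 * (1 - lam * \<rho>r)\<^sup>2 * lam))"
  shows "(MIN k\<in>{0..K-1}. D_sym \<omega> lam (bregman_prox \<omega> lam F (x k)) (x k))
    \<le> (gap lam (x 0) + (\<alpha> * CF + \<beta>) / (2 * lam * (1 - lam * \<rho>r)\<^sup>2) * (\<Sum>k=0..K-1. (t k)\<^sup>2))
      / ((1 - lam * \<rho>F) * (\<Sum>k=0..K-1. t k))"
proof (rule rate_bounded_subdiff[OF iterates K _ _ _ t lam(1) parameter_bound[OF lam(2)]])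
  fix k assume "k < K"
  then have "gap lam (x k) \<le> CF"
    unfolding CF using sub \<alpha> \<beta>
    by (intro gap_growth_bound[OF iterates _ _ _ t lam(1) parameter_bound[OF lam(2)] C]) simp_all
  then show "\<alpha> * gap lam (x k) + \<beta> \<le> \<alpha> * CF + \<beta>" using \<alpha> by simp
qed (use sub \<alpha> \<beta> in simp_all)

text \<open>The first candidate keeps \<open>t k\<close> below the parameter, the second balances
  the error against \<open>\<delta>\<close>, and the third gives
  \<open>K * T\<^sup>2 \<le> C\<close>, as the growth bound requires. Whichever attains the minimum
  selects its term in the maximum.\<close>

lemma rate_gap_bounded_subdiff_constant_step:
  assumes iterates: "bregman_prox_subgradient \<omega> \<rho>f f r t g x" and K: "0 < K"
    and \<alpha>: "0 < \<alpha>" and \<beta>: "0 < \<beta>"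
    and sub: "\<forall>z. \<forall>v\<in>rel_subdiff \<rho>F \<omega> F z. norm v \<le> sqrt (\<alpha> * gap (1 / (2 * \<rho>F)) z + \<beta>)"
    and C: "0 < C" and \<delta>: "0 < \<delta>" "gap (1 / (2 * \<rho>F)) (x 0) \<le> \<delta>"
    and CF: "CF = (\<delta> + 4 * C * \<beta> * \<rho>F) * exp (4 * C * \<alpha> * \<rho>F)"
    and t: "\<And>k. t k = Min {1 / (2 * \<rho>F),
      sqrt ((1 - \<rho>r / (2 * \<rho>F))\<^sup>2 * \<delta> / (\<rho>F * (\<alpha> * CF + \<beta>) * real K)), sqrt (C / real K)}"
  shows "(MIN k\<in>{0..K-1}. D_sym \<omega> (1 / (2 * \<rho>F)) (bregman_prox \<omega> (1 / (2 * \<rho>F)) F (x k)) (x k))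
    \<le> 8 * Max {\<rho>F * \<delta> / real K, sqrt ((\<alpha> * CF + \<beta>) * \<rho>F * \<delta> / real K), \<delta> / (2 * sqrt (C * real K))}"
    (is "?M \<le> _")
proof -
  define q where "q = 1 - \<rho>r / (2 * \<rho>F)"
  define B where "B = \<alpha> * CF + \<beta>"
  define T where "T = t 0"
  have \<rho>F: "0 < \<rho>F" using \<rho>f \<rho>r by simp
  have q: "1/2 \<le> q" unfolding q_def by (rule half_parameter)
  have CF_pos: "0 < CF" unfolding CF using \<delta> C \<beta> \<rho>f \<rho>r by (intro mult_pos_pos add_pos_pos) simp_all
  have B_pos: "0 < B" unfolding B_def using CF_pos \<alpha> \<beta> by (intro add_pos_pos mult_pos_pos)
  have tT: "t k = T" for k unfolding T_def t by (rule refl)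
  have b: "sqrt (q\<^sup>2 * \<delta> / (\<rho>F * B * real K)) = q * sqrt (\<delta> / (\<rho>F * B * real K))"
    using q by (simp add: real_sqrt_mult real_sqrt_divide)
  have T_eq: "T = min (1 / (2 * \<rho>F)) (min (q * sqrt (\<delta> / (\<rho>F * B * real K))) (sqrt (C / real K)))"
    unfolding T_def t q_def[symmetric] B_def[symmetric] b by simp
  have T_pos: "0 < T" using method_facts(1)[OF iterates, of 0] unfolding T_def .
  have "T\<^sup>2 \<le> (sqrt (C / real K))\<^sup>2" using T_pos unfolding T_eq by (intro power_mono) simp_all
  then have "T\<^sup>2 \<le> C / real K" using C by simp
  then have sum_C: "(\<Sum>k=0..K-1. (t k)\<^sup>2) \<le> C" using K by (simp add: tT pos_le_divide_eq mult.commute)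
  have growth: "gap (1 / (2 * \<rho>F)) (x k) \<le> CF" if "k < K" for k
  proof -
    have t_le: "t k \<le> 1 / (2 * \<rho>F)" for k unfolding tT T_eq by simp
    have "2 * (1 - 1 / (2 * \<rho>F) * \<rho>r)\<^sup>2 * (1 / (2 * \<rho>F)) = q\<^sup>2 / \<rho>F"
    proof -
      have "2 * a * (1 / (2 * b)) = a / b" for a b :: real by simp
      then show ?thesis unfolding half_parameter(5) q_def[symmetric] .
    qed
    then have "gap (1 / (2 * \<rho>F)) (x k)
        \<le> (gap (1 / (2 * \<rho>F)) (x 0) + C * \<beta> / (q\<^sup>2 / \<rho>F)) * exp (C * \<alpha> / (q\<^sup>2 / \<rho>F))"
      using gap_growth_bound[OF iterates _ _ _ t_le half_parameter(1,2) sum_C that, of \<alpha> \<beta>] sub \<alpha> \<beta> by simp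
    also have "\<dots> \<le> (\<delta> + 4 * C * \<beta> * \<rho>F) * exp (4 * C * \<alpha> * \<rho>F)"
    proof -
      have "(1/2)\<^sup>2 \<le> q\<^sup>2" using q by (intro power_mono) simp_all
      then have q2: "1 \<le> 4 * q\<^sup>2" by (simp add: power2_eq_square)
      \<comment> \<open>From \<open>q \<ge> 1/2\<close> follows
        \<open>1 / q\<^sup>2 \<le> 4\<close>, the origin of the factors 4 in
        \<open>CF\<close>.\<close>
      have scale: "C * c / (q\<^sup>2 / \<rho>) \<le> 4 * C * c * \<rho>" if c: "0 < c" "0 < \<rho>" for c \<rho>
      proof -
        have "C * c * \<rho> * 1 \<le> C * c * \<rho> * (4 * q\<^sup>2)"
          using q2 C c by (intro mult_left_mono) simp_all
        moreover have "0 < q\<^sup>2" using q by simp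
        ultimately show ?thesis by (simp add: pos_divide_le_eq mult_ac)
      qed
      show ?thesis
      proof (rule mult_mono)
        show "gap (1 / (2 * \<rho>F)) (x 0) + C * \<beta> / (q\<^sup>2 / \<rho>F) \<le> \<delta> + 4 * C * \<beta> * \<rho>F"
          using \<delta>(2) scale[OF \<beta> \<rho>F] by (rule add_mono)
        show "exp (C * \<alpha> / (q\<^sup>2 / \<rho>F)) \<le> exp (4 * C * \<alpha> * \<rho>F)" using scale[OF \<alpha> \<rho>F] by simp
        show "0 \<le> \<delta> + 4 * C * \<beta> * \<rho>F" using \<delta> C \<beta> \<rho>F by simp
      qed simp
    qed
    finally show ?thesis unfolding CF .
  qed
  have M: "?M \<le> 4 * (\<delta> / (real K * T))"
  proof (rule rate_bounded_subdiff_constant_step[OF iterates K _ _ _ B_pos _ \<delta> tT])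
    show "\<alpha> * gap (1 / (2 * \<rho>F)) (x k) + \<beta> \<le> B" if "k < K" for k
      unfolding B_def using growth[OF that] \<alpha> by simp
    show "T \<le> 1 / (2 * \<rho>F)" "T \<le> (1 - \<rho>r / (2 * \<rho>F)) * sqrt (\<delta> / (\<rho>F * B * real K))"
      unfolding T_eq q_def[symmetric] by simp_all
  qed (use sub \<alpha> \<beta> in simp_all)
  have max_eq: "Max {\<rho>F * \<delta> / real K, sqrt (B * \<rho>F * \<delta> / real K), \<delta> / (2 * sqrt (C * real K))}
    = max (\<rho>F * \<delta> / real K) (max (sqrt (B * \<rho>F * \<delta> / real K)) (\<delta> / (2 * sqrt (C * real K))))"
    by simp
  consider "T = 1 / (2 * \<rho>F)" | "T = q * sqrt (\<delta> / (\<rho>F * B * real K))" | "T = sqrt (C / real K)"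
    unfolding T_eq by linarith
  then have "4 * (\<delta> / (real K * T))
    \<le> 8 * Max {\<rho>F * \<delta> / real K, sqrt (B * \<rho>F * \<delta> / real K), \<delta> / (2 * sqrt (C * real K))}"
  proof cases
    case 1
    have "4 * (\<delta> / (real K * T)) = 8 * (\<rho>F * \<delta> / real K)" unfolding 1 by simp
    then show ?thesis unfolding max_eq by linarith
  next
    case 2
    have "4 * (\<delta> / (real K * T)) \<le> 8 * sqrt (B * \<rho>F * \<delta> / real K)"
      unfolding 2 using \<delta> \<rho>F B_pos K q by (intro step_scale_bound) simp_all
    then show ?thesis unfolding max_eq by linarith
  next
    case 3
    have "real K * T = sqrt (C * real K)"
      unfolding 3 using K by (simp add: real_sqrt_mult real_sqrt_divide field_simps)
    then have "4 * (\<delta> / (real K * T)) = 8 * (\<delta> / (2 * sqrt (C * real K)))" by simp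
    then show ?thesis unfolding max_eq by linarith
  qed
  with M show ?thesis unfolding B_def by (rule order_trans)
qed

lemma rate_Lipschitz_constant_step:
  assumes iterates: "bregman_prox_subgradient \<omega> \<rho>f f r t g x" and K: "0 < K"
    and L: "0 < L" and sub: "\<forall>z. \<forall>v\<in>rel_subdiff \<rho>f \<omega> f z. norm v \<le> L"
    and x0: "r (x 0) < \<infinity>"
    and \<delta>: "0 < \<delta>" "gap (1 / (2 * \<rho>F)) (x 0) \<le> \<delta>" "real_of_ereal (F (x 0)) - Fstar \<le> \<delta>"
    and t: "\<And>k. t k = min (1 / (2 * \<rho>F)) (1 / (2 * L) * sqrt (\<delta> / (\<rho>F * real K)))"
  shows "(MIN k\<in>{0..K-1}. D_sym \<omega> (1 / (2 * \<rho>F)) (bregman_prox \<omega> (1 / (2 * \<rho>F)) F (x k)) (x k))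
    \<le> 8 * max (3 * \<rho>F * \<delta> / real K) (4 * L * sqrt (\<rho>F * \<delta> / real K))" (is "?M \<le> _")
proof -
  define T where "T = min (1 / (2 * \<rho>F)) (1 / (2 * L) * sqrt (\<delta> / (\<rho>F * real K)))"
  have \<rho>F: "0 < \<rho>F" using \<rho>f \<rho>r by simp
  have T_pos: "0 < T" using method_facts(1)[OF iterates, of 0] unfolding T_def t .
  have tT: "t = (\<lambda>_. T)" using t unfolding T_def by blast
  have T_le: "T \<le> 1 / (2 * \<rho>F)" "T \<le> 1 / (2 * L) * sqrt (\<delta> / (\<rho>F * real K))" unfolding T_def by simp_all
  have "T * \<rho>r \<le> 1 / (2 * \<rho>F) * \<rho>r" using T_le \<rho>r by (intro mult_right_mono) simp_all
  then have T\<rho>: "0 < 1 - T * \<rho>r" using half_parameter(4,5) by linarith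
  have M: "?M \<le> 6 * (\<delta> / (real K * T))"
  proof (rule constant_step_rate_Lipschitz[OF \<delta>(1) \<rho>F L T_pos K _ _ refl _ \<delta>(2,3) T_le])
    show "?M \<le> (gap (1 / (2 * \<rho>F)) (x 0)
        + T / (1 / (2 * \<rho>F) * (1 - T * \<rho>r)) * (real_of_ereal (F (x 0)) - Fstar)
        + 2 * L\<^sup>2 / (1 / (2 * \<rho>F)) * (\<Sum>k=0..K-1. T\<^sup>2 / (1 - T * \<rho>r)))
      / ((1 - 1 / (2 * \<rho>F) * \<rho>F) * (\<Sum>k=0..K-1. T / (1 - T * \<rho>r)))"
      by (rule rate_Lipschitz[OF iterates K _ x0 _ _ half_parameter(1,2), of L, unfolded tT])
        (use sub T\<rho> in \<open>auto simp: monotone_on_def\<close>)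
  qed (use \<rho>f \<rho>r gap_nonneg[OF half_parameter(1,2)] in simp_all)
  \<comment> \<open>The factor 6 yields 4 times the first or 3 times the second term of the maximum,
    so 8 suffices in both cases.\<close>
  have max_ge: "4 * u \<le> 8 * max u v" "3 * v \<le> 8 * max u v" if "0 \<le> u" "0 \<le> v" for u v :: real
    using that by linarith+
  have nonneg: "0 \<le> 3 * \<rho>F * \<delta> / real K" "0 \<le> 4 * L * sqrt (\<rho>F * \<delta> / real K)"
    using \<rho>f \<rho>r \<delta> L by simp_all
  consider "T = 1 / (2 * \<rho>F)" | "T = 1 / (2 * L) * sqrt (\<delta> / (\<rho>F * real K))"
    unfolding T_def by linarith
  then show ?thesis
  proof cases
    case 1
    have eq: "6 * (\<delta> / (real K * T)) = 4 * (3 * \<rho>F * \<delta> / real K)" unfolding 1 by simp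
    show ?thesis
      using M unfolding eq by (rule order_trans) (rule max_ge(1)[OF nonneg])
  next
    case 2
    have "6 * (\<delta> / (real K * T)) = 12 * L * (\<delta> / (real K * sqrt (\<delta> / (\<rho>F * 1 * real K))))"
      unfolding 2 by (simp add: mult_ac)
    also have "\<dots> = 12 * L * sqrt (1 * \<rho>F * \<delta> / real K)"
      using \<delta> \<rho>F K by (subst sqrt_ratio) simp_all
    finally have eq: "6 * (\<delta> / (real K * T)) = 3 * (4 * L * sqrt (\<rho>F * \<delta> / real K))" by simp
    show ?thesis
      using M unfolding eq by (rule order_trans) (rule max_ge(2)[OF nonneg])
  qed
qed

end

text \<open>Index 1 is used because \<open>x 0\<close> may lie outside the domain of
  \<open>r\<close>: \<open>x 1\<close> minimises a subproblem that is finite somewhere, and the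
  subgradient \<open>g 1\<close> makes \<open>f (x 1)\<close> finite.\<close>

lemma method_imp_finite_objective:
  assumes iterates: "bregman_prox_subgradient \<omega> \<rho>f f r t g x" and r: "proper_fun r"
  shows "f (x 1) + r (x 1) < \<infinity>"
proof -
  obtain z where z: "r z < \<infinity>" using r unfolding proper_fun_def by blast
  have "g 1 \<in> rel_subdiff \<rho>f \<omega> f (x 1)"
    and "is_arg_min (\<lambda>z. ereal (g 0 \<bullet> (z - x 0)) + r z + ereal (1 / t 0 * bregman \<omega> z (x 0))) (\<lambda>_. True) (x 1)"
    using iterates unfolding bregman_prox_subgradient_def One_nat_def by blast+
  then have "\<bar>f (x 1)\<bar> \<noteq> \<infinity>"
    and "ereal (g 0 \<bullet> (x 1 - x 0)) + r (x 1) + ereal (1 / t 0 * bregman \<omega> (x 1) (x 0))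
      \<le> ereal (g 0 \<bullet> (z - x 0)) + r z + ereal (1 / t 0 * bregman \<omega> z (x 0))"
    unfolding rel_subdiff_iff by (simp_all add: is_arg_min_linorder)
  then show ?thesis using z by (cases "f (x 1)"; cases "r (x 1)"; cases "r z") auto
qed

theorem theorem2p1:
  fixes \<omega> :: "real ^ 'd \<Rightarrow> real"
    and f r F :: "real ^ 'd \<Rightarrow> ereal"
    and \<rho>f \<rho>r \<rho>F Fstar :: real
    and t :: "nat \<Rightarrow> real"
    and g x :: "nat \<Rightarrow> real ^ 'd"
    and K :: nat
  assumes "continuously_differentiable \<omega>" and "strongly_convex_1 \<omega>"
    and "proper_fun f" and "lower_semicont f"
    and "proper_fun r" and "lower_semicont r"
    and "\<rho>f > 0" and "\<rho>r > 0"
    and "rel_weakly_convex \<rho>f \<omega> f" and "rel_weakly_convex \<rho>r \<omega> r"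
    and F_eq: "F = (\<lambda>z. f z + r z)" and \<rho>F_eq: "\<rho>F = \<rho>f + \<rho>r"
    and F_bdd_below: "(INF z. F z) > -\<infinity>"
    and Fstar_eq: "Fstar = real_of_ereal (INF z. F z)"
    and "bregman_prox_subgradient \<omega> \<rho>f f r t g x"
    and "K > 0"
  shows
    "\<comment> \<open>part (a)\<close>
     (\<forall>LF>0. (\<forall>z. \<forall>v \<in> rel_subdiff \<rho>F \<omega> F z. norm v \<le> LF) \<longrightarrow>
        (\<forall>lam. 0 < lam \<and> lam < 1 / \<rho>F \<and> (\<forall>k. 0 < t k \<and> t k \<le> lam) \<longrightarrow>
           (MIN k\<in>{0..K-1}. D_sym \<omega> lam (bregman_prox \<omega> lam F (x k)) (x k))
           \<le> (real_of_ereal (bregman_envelope \<omega> lam F (x 0)) - Fstar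
                + LF\<^sup>2 / (2 * lam * (1 - lam * \<rho>r)\<^sup>2) * (\<Sum>k=0..K-1. (t k)\<^sup>2))
              / ((1 - lam * \<rho>F) * (\<Sum>k=0..K-1. t k)))
      \<and> (\<forall>\<delta>>0. \<delta> \<ge> real_of_ereal (bregman_envelope \<omega> (1 / (2 * \<rho>F)) F (x 0)) - Fstar \<and>
           (\<forall>k. t k = min (1 / (2 * \<rho>F))
                        ((1 - \<rho>r / (2 * \<rho>F)) / LF * sqrt (\<delta> / (\<rho>F * real K)))) \<longrightarrow>
           (MIN k\<in>{0..K-1}. D_sym \<omega> (1 / (2 * \<rho>F)) (bregman_prox \<omega> (1 / (2 * \<rho>F)) F (x k)) (x k))
           \<le> 8 * max (\<rho>F * \<delta> / real K) (LF * sqrt (\<rho>F * \<delta> / real K))))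
     \<and>
     \<comment> \<open>part (b)\<close>
     (\<forall>\<alpha>1 \<beta>1 :: real \<Rightarrow> real.
        (\<forall>lam. 0 < lam \<and> lam < 1 / \<rho>F \<longrightarrow> \<alpha>1 lam > 0 \<and> \<beta>1 lam > 0 \<and>
           (\<forall>z. \<forall>v \<in> rel_subdiff \<rho>F \<omega> F z.
              norm v \<le> sqrt (\<alpha>1 lam * (real_of_ereal (bregman_envelope \<omega> lam F z) - Fstar) + \<beta>1 lam))) \<longrightarrow>
        (\<forall>lam C CF. 0 < lam \<and> lam < 1 / \<rho>F \<and> (\<forall>k. 0 < t k \<and> t k \<le> lam) \<and>
           C > 0 \<and> (\<Sum>k=0..K-1. (t k)\<^sup>2) \<le> C \<and>
           CF = (real_of_ereal (bregman_envelope \<omega> lam F (x 0)) - Fstar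
                   + C * \<beta>1 lam / (2 * (1 - lam * \<rho>r)\<^sup>2 * lam))
                * exp (C * \<alpha>1 lam / (2 * (1 - lam * \<rho>r)\<^sup>2 * lam)) \<longrightarrow>
           (MIN k\<in>{0..K-1}. D_sym \<omega> lam (bregman_prox \<omega> lam F (x k)) (x k))
           \<le> (real_of_ereal (bregman_envelope \<omega> lam F (x 0)) - Fstar
                + (\<alpha>1 lam * CF + \<beta>1 lam) / (2 * lam * (1 - lam * \<rho>r)\<^sup>2) * (\<Sum>k=0..K-1. (t k)\<^sup>2))
              / ((1 - lam * \<rho>F) * (\<Sum>k=0..K-1. t k)))
      \<and> (\<forall>Cb a1 b1 \<delta> CbF. Cb > 0 \<and> a1 = \<alpha>1 (1 / (2 * \<rho>F)) \<and> b1 = \<beta>1 (1 / (2 * \<rho>F)) \<and>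
           \<delta> > 0 \<and> \<delta> \<ge> real_of_ereal (bregman_envelope \<omega> (1 / (2 * \<rho>F)) F (x 0)) - Fstar \<and>
           CbF = (\<delta> + 4 * Cb * b1 * \<rho>F) * exp (4 * Cb * a1 * \<rho>F) \<and>
           (\<forall>k. t k = Min {1 / (2 * \<rho>F),
                        sqrt ((1 - \<rho>r / (2 * \<rho>F))\<^sup>2 * \<delta> / (\<rho>F * (a1 * CbF + b1) * real K)),
                        sqrt (Cb / real K)}) \<longrightarrow>
           (MIN k\<in>{0..K-1}. D_sym \<omega> (1 / (2 * \<rho>F)) (bregman_prox \<omega> (1 / (2 * \<rho>F)) F (x k)) (x k))
           \<le> 8 * Max {\<rho>F * \<delta> / real K,
                      sqrt ((a1 * CbF + b1) * \<rho>F * \<delta> / real K),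
                      \<delta> / (2 * sqrt (Cb * real K))}))
     \<and>
     \<comment> \<open>part (c)\<close>
     (\<forall>Lf>0. (\<forall>z. \<forall>v \<in> rel_subdiff \<rho>f \<omega> f z. norm v \<le> Lf) \<and> x 0 \<in> effective_dom r \<longrightarrow>
        (\<forall>lam. 0 < lam \<and> lam < 1 / \<rho>F \<and> antimono t \<and> (\<forall>k. 1 - t k * \<rho>r > 0) \<longrightarrow>
           (MIN k\<in>{0..K-1}. D_sym \<omega> lam (bregman_prox \<omega> lam F (x k)) (x k))
           \<le> (real_of_ereal (bregman_envelope \<omega> lam F (x 0)) - Fstar
                + t 0 / (lam * (1 - t 0 * \<rho>r)) * (real_of_ereal (F (x 0)) - Fstar)
                + 2 * Lf\<^sup>2 / lam * (\<Sum>k=0..K-1. (t k)\<^sup>2 / (1 - t k * \<rho>r)))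
              / ((1 - lam * \<rho>F) * (\<Sum>k=0..K-1. t k / (1 - t k * \<rho>r))))
      \<and> (\<forall>\<delta>>0. \<delta> \<ge> max (real_of_ereal (bregman_envelope \<omega> (1 / (2 * \<rho>F)) F (x 0)) - Fstar)
                         (real_of_ereal (F (x 0)) - Fstar) \<and>
           (\<forall>k. t k = min (1 / (2 * \<rho>F)) (1 / (2 * Lf) * sqrt (\<delta> / (\<rho>F * real K)))) \<longrightarrow>
           (MIN k\<in>{0..K-1}. D_sym \<omega> (1 / (2 * \<rho>F)) (bregman_prox \<omega> (1 / (2 * \<rho>F)) F (x k)) (x k))
           \<le> 8 * max (3 * \<rho>F * \<delta> / real K) (4 * Lf * sqrt (\<rho>F * \<delta> / real K))))"
proof -
  note iterates = assms(15) and K = assms(16)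
  have F_fin: "F (x 1) < \<infinity>"
    unfolding F_eq by (rule method_imp_finite_objective[OF iterates assms(5)])
  have "(INF z. F z) \<le> F (x 1)" by (rule INF_lower) simp
  \<comment> \<open>\<open>real_of_ereal\<close> sends infinite values to 0; the lower bound and the
    finite value at \<open>x 1\<close> rule out both infinities.\<close>
  then have Fstar: "ereal Fstar = (INF z. F z)"
    unfolding Fstar_eq using F_bdd_below F_fin by (cases "INF z. F z") auto
  interpret composite_problem \<omega> f r \<rho>f \<rho>r Fstar
  proof
    show "ereal Fstar \<le> f y + r y" for y
      using INF_lower[of y UNIV F] unfolding Fstar by (simp add: F_eq)
    show "\<exists>y. f y + r y < \<infinity>" using F_fin unfolding F_eq by blast
  qed (use assms in \<open>auto simp: proper_fun_def\<close>)
  show ?thesis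
    unfolding F_eq \<rho>F_eq gap_def[symmetric]
  proof (intro conjI allI impI, goal_cases)
    case (1 LF lam)
    then show ?case by (intro rate_uniformly_bounded_subdiff[OF iterates K]) auto
  next
    case (2 LF \<delta>)
    then show ?case by (intro rate_uniformly_bounded_subdiff_constant_step[OF iterates K]) auto
  next
    case (3 \<alpha>1 \<beta>1 lam C CF)
    then show ?case by (intro rate_gap_bounded_subdiff[OF iterates K]) auto
  next
    case (4 \<alpha>1 \<beta>1 Cb a1 b1 \<delta> CbF)
    then show ?case using half_parameter(1,3) by (intro rate_gap_bounded_subdiff_constant_step[OF iterates K]) auto
  next
    case (5 Lf lam)
    then show ?case using parameter_bound
      by (intro rate_Lipschitz[OF iterates K]) (auto simp: effective_dom_def)
  next
    case (6 Lf \<delta>)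
    then show ?case by (intro rate_Lipschitz_constant_step[OF iterates K]) (auto simp: effective_dom_def)
  qed
qed

end
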